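(* Let $N\in\mathbb{N}$ and assume that $$E_{\mathbb{Q}}\big[|P_T-1|^{n-k}\,|I_T-E_{\mathbb{Q}}[I_T]|^k\big]<\infty\quad\text{for all } n=1,\dots,N+1,\ k=0,\dots,n.$$ Then $\Pi_{\mathrm{Put}}(S_0,K,T)=\Pi_N+R_N$, where $$\Pi_N=\mathrm{BS}_{\mathrm{Put}}(S_0,E_{\mathbb{Q}}[I_T])+\sum_{n=2}^N\frac{1}{n!}\sum_{k=0}^n\binom{n}{k}S_0^{n-k}\,E_{\mathbb{Q}}\big[(P_T-1)^{n-k}(I_T-E_{\mathbb{Q}}[I_T])^k\big]\,\frac{\partial^n\mathrm{BS}_{\mathrm{Put}}}{\partial x^{n-k}\partial y^k}(S_0,E_{\mathbb{Q}}[I_T])$$ (the sum being empty if $N=1$) and $$R_N=\frac{1}{N!}\sum_{n=0}^{N+1}\binom{N+1}{n}S_0^{N+1-n}E_{\mathbb{Q}}\Big[(P_T-1)^{N+1-n}(I_T-E_{\mathbb{Q}}[I_T])^n\int_0^1(1-u)^N\frac{\partial^{N+1}\mathrm{BS}_{\mathrm{Put}}}{\partial x^{N+1-n}\partial y^n}\big((1-u)S_0+uP_TS_0,\,(1-u)E_{\mathbb{Q}}[I_T]+uI_T\big)\,du\Big].$$ All derivatives appearing are evaluated at points with both coordinates positive (almost surely for those inside $R_N$), and all expectations are finite.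
   Context: Barndorff-Nielsen–Shephard model. Fix $T>0$, $r\in\mathbb{R}$, $\lambda>0$, $\sigma_0^2>0$, $S_0>0$, strike $K>0$, $\rho\in\mathbb{R}$. On a probability space with measure $\mathbb{Q}$ let $W$ be a standard Brownian motion and $Z$ an independent Lévy subordinator (nondecreasing Lévy process, $Z_0=0$). Let $\kappa(\theta)=\ln E_{\mathbb{Q}}[e^{\theta Z_1}]\in(-\infty,\infty]$ and $\hat\kappa=\sup\{\theta:\kappa(\theta)<\infty\}$; assume $\hat\kappa>0$ and $\rho<\hat\kappa$. Set $\alpha_{s,t}=\frac1\lambda(1-e^{-\lambda(t-s)})$, variance $\sigma_t^2=e^{-\lambda t}(\sigma_0^2+\int_0^te^{\lambda s}dZ_{\lambda s})$ (pathwise Stieltjes integrals), integrated variance $I_t=\int_0^t\sigma_s^2ds=\sigma_0^2\alpha_{0,t}+\int_0^t\alpha_{s,t}\,dZ_{\lambda s}$, $P_t=e^{\rho Z_{\lambda t}-\lambda t\kappa(\rho)}$, and stock price $S_t=S_0P_t\exp(rt-\tfrac12I_t+\int_0^t\sigma_sdW_s)$. The put price is $\Pi_{\mathrm{Put}}(S_0,K,T)=E_{\mathbb{Q}}[e^{-rT}(K-S_T)^+]$. For $x,y>0$, $\mathrm{BS}_{\mathrm{Put}}(x,y)=Ke^{-rT}\Phi(-d_-(x,y))-x\Phi(-d_+(x,y))$ with $d_\pm(x,y)=\frac{1}{\sqrt y}(\ln\frac xK+rT\pm\frac12 y)$ and $\Phi$ the standard normal cdf. *)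

theory Defs
  imports "HOL-Probability.Probability"
begin

definition Phi :: "real \<Rightarrow> real" where
  "Phi x = measure (density lborel std_normal_density) {..x}"

definition d_plus :: "real \<Rightarrow> real \<Rightarrow> real \<Rightarrow> real \<Rightarrow> real \<Rightarrow> real" where
  "d_plus K r T x y = (ln (x / K) + r * T + y / 2) / sqrt y"

definition d_minus :: "real \<Rightarrow> real \<Rightarrow> real \<Rightarrow> real \<Rightarrow> real \<Rightarrow> real" where
  "d_minus K r T x y = (ln (x / K) + r * T - y / 2) / sqrt y"

definition BS_put :: "real \<Rightarrow> real \<Rightarrow> real \<Rightarrow> real \<Rightarrow> real \<Rightarrow> real" where
  "BS_put K r T x y =
     K * exp (- r * T) * Phi (- d_minus K r T x y) - x * Phi (- d_plus K r T x y)"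

definition dx :: "(real \<Rightarrow> real \<Rightarrow> real) \<Rightarrow> real \<Rightarrow> real \<Rightarrow> real" where
  "dx f = (\<lambda>x y. deriv (\<lambda>x'. f x' y) x)"

definition dy :: "(real \<Rightarrow> real \<Rightarrow> real) \<Rightarrow> real \<Rightarrow> real \<Rightarrow> real" where
  "dy f = (\<lambda>x y. deriv (\<lambda>y'. f x y') y)"

definition mixed_partial :: "nat \<Rightarrow> nat \<Rightarrow> (real \<Rightarrow> real \<Rightarrow> real) \<Rightarrow> real \<Rightarrow> real \<Rightarrow> real" where
  "mixed_partial a b f = (dx ^^ a) ((dy ^^ b) f)"

definition indep_increments :: "'a measure \<Rightarrow> (real \<Rightarrow> 'a \<Rightarrow> real) \<Rightarrow> bool" where
  "indep_increments M X \<longleftrightarrow>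
     (\<forall>ts :: real list. sorted ts \<and> (\<forall>t\<in>set ts. 0 \<le> t) \<longrightarrow>
        prob_space.indep_vars M (\<lambda>_. borel) (\<lambda>i \<omega>. X (ts ! Suc i) \<omega> - X (ts ! i) \<omega>)
          {..<length ts - 1})"

definition brownian_motion :: "'a measure \<Rightarrow> (real \<Rightarrow> 'a \<Rightarrow> real) \<Rightarrow> bool" where
  "brownian_motion M W \<longleftrightarrow>
     (\<forall>\<omega>\<in>space M. W 0 \<omega> = 0 \<and> continuous_on {0..} (\<lambda>t. W t \<omega>)) \<and>
     (\<forall>t. W t \<in> borel_measurable M) \<and>
     indep_increments M W \<and>
     (\<forall>s t. 0 \<le> s \<and> s < t \<longrightarrow>
        distributed M lborel (\<lambda>\<omega>. W t \<omega> - W s \<omega>) (normal_density 0 (sqrt (t - s))))"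

definition subordinator :: "'a measure \<Rightarrow> (real \<Rightarrow> 'a \<Rightarrow> real) \<Rightarrow> bool" where
  "subordinator M Z \<longleftrightarrow>
     (\<forall>\<omega>\<in>space M. Z 0 \<omega> = 0 \<and> mono_on {0..} (\<lambda>t. Z t \<omega>) \<and>
        (\<forall>t\<ge>0. continuous (at_right t) (\<lambda>s. Z s \<omega>))) \<and>
     (\<forall>t. Z t \<in> borel_measurable M) \<and>
     indep_increments M Z \<and>
     (\<forall>s t. 0 \<le> s \<and> 0 \<le> t \<longrightarrow>
        distr M borel (\<lambda>\<omega>. Z (s + t) \<omega> - Z s \<omega>) = distr M borel (Z t))"

text \<open>kappa(theta) = ln E[exp(theta Z_1)] (used only where finite) and
  kappa_hat = sup {theta. kappa(theta) < infinity}.\<close>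
definition kappa :: "'a measure \<Rightarrow> (real \<Rightarrow> 'a \<Rightarrow> real) \<Rightarrow> real \<Rightarrow> real" where
  "kappa M Z \<theta> = ln (integral\<^sup>L M (\<lambda>\<omega>. exp (\<theta> * Z 1 \<omega>)))"

definition kappa_hat :: "'a measure \<Rightarrow> (real \<Rightarrow> 'a \<Rightarrow> real) \<Rightarrow> ereal" where
  "kappa_hat M Z = Sup (ereal ` {\<theta>. (\<integral>\<^sup>+\<omega>. ennreal (exp (\<theta> * Z 1 \<omega>)) \<partial>M) < \<infinity>})"

definition sigma2 :: "real \<Rightarrow> real \<Rightarrow> (real \<Rightarrow> 'a \<Rightarrow> real) \<Rightarrow> real \<Rightarrow> 'a \<Rightarrow> real" where
  "sigma2 lam s0sq Z t \<omega> =
     exp (- lam * t) * (s0sq +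
       (LINT s:{0..t}|interval_measure (\<lambda>s. Z (lam * max s 0) \<omega>). exp (lam * s)))"

definition intvar :: "real \<Rightarrow> real \<Rightarrow> (real \<Rightarrow> 'a \<Rightarrow> real) \<Rightarrow> real \<Rightarrow> 'a \<Rightarrow> real" where
  "intvar lam s0sq Z t \<omega> = (LINT s:{0..t}|lborel. sigma2 lam s0sq Z s \<omega>)"

text \<open>Left-point Riemann sums of int_0^T sigma_s dW_s along dyadic partitions.\<close>
definition dyadic_sum ::
  "real \<Rightarrow> real \<Rightarrow> (real \<Rightarrow> 'a \<Rightarrow> real) \<Rightarrow> (real \<Rightarrow> 'a \<Rightarrow> real) \<Rightarrow> real \<Rightarrow> nat \<Rightarrow> 'a \<Rightarrow> real" where
  "dyadic_sum lam s0sq Z W T n \<omega> =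
     (\<Sum>i<2^n. sqrt (sigma2 lam s0sq Z (real i * T / 2^n) \<omega>) *
        (W (real (Suc i) * T / 2^n) \<omega> - W (real i * T / 2^n) \<omega>))"

definition conv_in_prob :: "'a measure \<Rightarrow> (nat \<Rightarrow> 'a \<Rightarrow> real) \<Rightarrow> ('a \<Rightarrow> real) \<Rightarrow> bool" where
  "conv_in_prob M X Y \<longleftrightarrow>
     (\<forall>\<epsilon>>0. (\<lambda>n. measure M {\<omega>\<in>space M. \<epsilon> < \<bar>X n \<omega> - Y \<omega>\<bar>}) \<longlonglongrightarrow> 0)"

end

theory Submission
  imports Defs
begin

text \<open>Conditionally on the path of the subordinator the dyadic sums approximating the stochastic integral
  are centred Gaussian, with variances that are Riemann sums of the integrated variance. Passing to the limit,
  the put price is the expectation of \<open>BS_put\<close> at the random point \<open>(S0 * P, I)\<close>, and the theorem is the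
  expectation of Taylor's formula along the segment from \<open>(S0, EI)\<close> to this point; the first order terms
  vanish because \<open>P\<close> has mean 1 and \<open>EI\<close> is the mean of \<open>I\<close>.

  The partial derivatives of order at least two are in general unbounded on the quadrant, even for
  \<open>y\<close> away from 0. But \<open>\<partial>\<^sub>x\<^sup>a \<partial>\<^sub>y\<^sup>b BS_put\<close> is of order \<open>x\<close> to the power \<open>1 - a\<close> for \<open>a \<ge> 1\<close>, and
  bounded for \<open>a = 0\<close>; since \<open>x \<ge> (1 - u) * S0\<close> on the segment, the weight \<open>(1 - u) ^ N\<close> in the
  remainder compensates this, so that the remainder is controlled by the assumed moments alone.\<close>

subsection \<open>Smooth functions on the open quadrant\<close>

text \<open>\<open>Y\<close> is known only as a limit in probability, so no conditional law of
  \<open>Y\<close> is at hand. Conditioning is therefore done before the limit: at a fixed dyadic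
  level, Fubini on the product law of the two paths freezes the whole path of \<open>Z\<close>,
  hence both the variances and the factor \<open>P\<close>. The limit is then harmless because a put
  payoff, unlike that of a call, is bounded: \<open>K\<close> dominates both sides.

  Derivatives of every order are needed at once. They are expressions in \<open>1 / x\<close>,
  \<open>d_minus\<close>, \<open>1 / sqrt y\<close> and a Gaussian factor, a family closed under
  both partial derivatives, so one growth bound for its generators serves all orders. Exchanging the
  Gaussian in d_- for the one in d_+ gains a factor x there; this turns x^(-a) into x^(1 - a), and
  as a is at most N + 1, the N powers of 1 - u just suffice.

  The behaviour near y = 0 never enters, since nonnegative jumps keep \<open>I\<close> above a
  deterministic positive number. That \<open>P\<close> has mean 1 concerns time
  \<open>lam * T\<close>, whereas \<open>kappa\<close> is defined at time 1; Cauchy's functional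
  equation bridges the gap.\<close>

definition has_partials ::
  "(real \<Rightarrow> real \<Rightarrow> real) \<Rightarrow> (real \<Rightarrow> real \<Rightarrow> real) \<Rightarrow> (real \<Rightarrow> real \<Rightarrow> real) \<Rightarrow> bool" where
  "has_partials f fx fy \<longleftrightarrow> (\<forall>x>0. \<forall>y>0.
     ((\<lambda>p. f (fst p) (snd p)) has_derivative (\<lambda>h. fx x y * fst h + fy x y * snd h)) (at (x, y)))"

lemma has_partialsI:
  assumes "\<And>x y. x > 0 \<Longrightarrow> y > 0 \<Longrightarrow>
     ((\<lambda>p. f (fst p) (snd p)) has_derivative (\<lambda>h. fx x y * fst h + fy x y * snd h)) (at (x, y))"
  shows "has_partials f fx fy"
  using assms unfolding has_partials_def by simp

lemma has_partialsD:
  assumes "has_partials f fx fy" "x > 0" "y > 0"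
  shows "((\<lambda>p. f (fst p) (snd p)) has_derivative (\<lambda>h. fx x y * fst h + fy x y * snd h)) (at (x, y))"
  using assms unfolding has_partials_def by simp

text \<open>\<open>deriv\<close> returns some value even where no derivative exists; this ties
  \<open>dx f\<close> and \<open>dy f\<close> to a genuine derivative. Frechet differentiability,
  rather than mere existence of the partials, is what the chain rule along a segment needs.\<close>

definition total_diff :: "(real \<Rightarrow> real \<Rightarrow> real) \<Rightarrow> bool" where
  "total_diff f \<longleftrightarrow> has_partials f (dx f) (dy f)"

text \<open>Infinite differentiability as a greatest fixed point: a family of totally differentiable
  functions closed under \<open>dx\<close> and \<open>dy\<close> is smooth by coinduction, without
  counting orders.\<close>

coinductive smooth_quadrant :: "(real \<Rightarrow> real \<Rightarrow> real) \<Rightarrow> bool" where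
  smooth_quadrantI:
    "total_diff f \<Longrightarrow> smooth_quadrant (dx f) \<Longrightarrow> smooth_quadrant (dy f) \<Longrightarrow> smooth_quadrant f"

lemma smooth_quadrantD:
  assumes "smooth_quadrant f"
  shows "total_diff f" "smooth_quadrant (dx f)" "smooth_quadrant (dy f)"
  using assms by (auto elim: smooth_quadrant.cases)

lemma partials_of_total_derivative:
  assumes "((\<lambda>p. f (fst p) (snd p)) has_derivative (\<lambda>h. A * fst h + B * snd h)) (at (x, y))"
  shows "((\<lambda>x'. f x' y) has_real_derivative A) (at x)"
    and "((\<lambda>y'. f x y') has_real_derivative B) (at y)"
proof -
  have "((\<lambda>x'. (x', y)) has_derivative (\<lambda>h. (h, 0))) (at x)"
    by (auto intro!: derivative_eq_intros)
  from has_derivative_compose[OF this assms]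
  show "((\<lambda>x'. f x' y) has_real_derivative A) (at x)"
    by (simp add: has_field_derivative_def)
  have "((\<lambda>y'. (x, y')) has_derivative (\<lambda>h. (0, h))) (at y)"
    by (auto intro!: derivative_eq_intros)
  from has_derivative_compose[OF this assms]
  show "((\<lambda>y'. f x y') has_real_derivative B) (at y)"
    by (simp add: has_field_derivative_def)
qed

lemma dx_dy_eqI:
  assumes "((\<lambda>p. f (fst p) (snd p)) has_derivative (\<lambda>h. A * fst h + B * snd h)) (at (x, y))"
  shows "dx f x y = A" "dy f x y = B"
  using partials_of_total_derivative[OF assms] by (auto simp: dx_def dy_def DERIV_imp_deriv)

lemma has_derivative_cong_quadrant:
  assumes "((\<lambda>p. f (fst p) (snd p)) has_derivative D) (at (x, y))"
    and "\<And>x y. x > 0 \<Longrightarrow> y > 0 \<Longrightarrow> g x y = f x y" and "x > 0" "y > (0::real)"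
  shows "((\<lambda>p. g (fst p) (snd p)) has_derivative D) (at (x::real, y))"
  by (rule has_derivative_transform_within_open[OF assms(1), where s="{0<..} \<times> {0<..}"])
    (auto simp: assms intro: open_Times)

lemma total_diffD:
  assumes "total_diff f" "x > 0" "y > 0"
  shows "((\<lambda>x'. f x' y) has_real_derivative dx f x y) (at x)"
    and "((\<lambda>y'. f x y') has_real_derivative dy f x y) (at y)"
proof -
  have "((\<lambda>p. f (fst p) (snd p)) has_derivative (\<lambda>h. dx f x y * fst h + dy f x y * snd h)) (at (x, y))"
    using assms unfolding total_diff_def has_partials_def by blast
  from partials_of_total_derivative[OF this]
  show "((\<lambda>x'. f x' y) has_real_derivative dx f x y) (at x)"
    and "((\<lambda>y'. f x y') has_real_derivative dy f x y) (at y)" .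
qed

lemma total_diff_continuous_on:
  assumes "total_diff f"
  shows "continuous_on ({0<..} \<times> {0<..}) (\<lambda>p. f (fst p) (snd p))"
proof (intro continuous_at_imp_continuous_on ballI)
  fix p :: "real \<times> real" assume p: "p \<in> {0<..} \<times> {0<..}"
  then have "fst p > 0" "snd p > 0" by auto
  with assms have "((\<lambda>p. f (fst p) (snd p)) has_derivative
      (\<lambda>h. dx f (fst p) (snd p) * fst h + dy f (fst p) (snd p) * snd h)) (at (fst p, snd p))"
    unfolding total_diff_def has_partials_def by blast
  from has_derivative_continuous[OF this] show "isCont (\<lambda>p. f (fst p) (snd p)) p"
    by simp
qed

lemma total_diff_continuous_on_compose:
  assumes "total_diff f" "continuous_on A g" "continuous_on A h"
    and "\<And>t. t \<in> A \<Longrightarrow> g t > 0" "\<And>t. t \<in> A \<Longrightarrow> h t > 0"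
  shows "continuous_on A (\<lambda>t. f (g t) (h t))"
  using continuous_on_compose2[OF total_diff_continuous_on[OF assms(1)], of A "\<lambda>t. (g t, h t)"] assms
  by (force intro: continuous_intros)

text \<open>Schwarz' theorem: write \<open>f x y = f x\<^sub>0 y + (integral of f\<^sub>x over [x\<^sub>0, x])\<close> and differentiate
  in \<open>y\<close> under the integral sign.\<close>
lemma dx_dy_commute:
  assumes f: "total_diff f" and fx: "total_diff (dx f)" and fxy: "total_diff (dy (dx f))"
    and x: "x > 0" and y: "y > 0"
  shows "dx (dy f) x y = dy (dx f) x y"
proof -
  \<comment> \<open>The interval from \<open>x / 2\<close> to \<open>2 * x\<close> stays to the
    right of 0 and has \<open>x\<close> in its interior, so a derivative within it is a derivative
    at \<open>x\<close>.\<close>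
  define a where "a = x / 2"
  have a: "a > 0" "a < x" using x by (auto simp: a_def)
  define b where "b = 2 * x"
  have eq: "dy f x' y = dy f a y + integral {a..x'} (\<lambda>t. dy (dx f) t y)" if x': "x' \<in> {a..b}" for x'
  proof -
    have 1: "f x' y' = f a y' + integral {a..x'} (\<lambda>t. dx f t y')" if "y' > 0" for y'
    proof -
      have "((\<lambda>t. dx f t y') has_integral (f x' y' - f a y')) {a..x'}"
        using x' a that
        by (intro fundamental_theorem_of_calculus)
          (auto intro!: total_diffD(1)[OF f, THEN has_field_derivative_at_within]
             simp flip: has_real_derivative_iff_has_vector_derivative)
      then show ?thesis by (simp add: integral_unique)
    qed
    have 2: "((\<lambda>y'. integral (cbox a x') (\<lambda>t. dx f t y')) has_real_derivative
        integral (cbox a x') (\<lambda>t. dy (dx f) t y)) (at y within {0<..})"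
    proof (rule leibniz_rule_field_derivative[where fx="\<lambda>y t. dy (dx f) t y"])
      show "((\<lambda>x. dx f t x) has_real_derivative dy (dx f) t y) (at y within {0<..})"
        if "y \<in> {0<..}" "t \<in> cbox a x'" for y t
        using that a by (auto intro!: total_diffD(2)[OF fx, THEN has_field_derivative_at_within])
      show "(\<lambda>t. dx f t y) integrable_on cbox a x'" if "y \<in> {0<..}" for y
        using that a unfolding cbox_interval
        by (intro integrable_continuous_interval total_diff_continuous_on_compose[OF fx] continuous_on_id continuous_on_const) auto
      show "continuous_on ({0<..} \<times> cbox a x') (\<lambda>(x, t). dy (dx f) t x)"
        using a unfolding case_prod_beta
        by (intro total_diff_continuous_on_compose[OF fxy] continuous_on_fst continuous_on_snd continuous_on_id) auto
    qed (use y in auto)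
    have "((\<lambda>y'. f a y' + integral {a..x'} (\<lambda>t. dx f t y')) has_real_derivative
        dy f a y + integral {a..x'} (\<lambda>t. dy (dx f) t y)) (at y)"
      using 2 y a by (intro DERIV_add total_diffD(2)[OF f]) (auto simp: at_within_open[of _ "{0<..}"])
    then have "((\<lambda>y'. f x' y') has_real_derivative
        dy f a y + integral {a..x'} (\<lambda>t. dy (dx f) t y)) (at y)"
      using y 1 by (elim DERIV_cong_ev[OF refl, THEN iffD1, rotated 2])
        (auto intro!: eventually_nhds_in_open[of "{0<..}", THEN eventually_mono])
    then show ?thesis by (simp add: dy_def DERIV_imp_deriv)
  qed
  have "((\<lambda>x'. integral {a..x'} (\<lambda>t. dy (dx f) t y)) has_real_derivative dy (dx f) x y)
      (at x within {a..b})"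
    using a x y by (intro integral_has_real_derivative total_diff_continuous_on_compose[OF fxy]
        continuous_on_id continuous_on_const) (auto simp: b_def)
  then have "((\<lambda>x'. dy f a y + integral {a..x'} (\<lambda>t. dy (dx f) t y)) has_real_derivative dy (dx f) x y)
      (at x within {a..b})"
    by (auto intro!: derivative_eq_intros)
  then have "((\<lambda>x'. dy f x' y) has_real_derivative dy (dx f) x y) (at x within {a..b})"
    by (rule has_field_derivative_transform_within[OF _ zero_less_one _ eq[symmetric]])
      (use a b_def in auto)
  then have "((\<lambda>x'. dy f x' y) has_real_derivative dy (dx f) x y) (at x)"
    using a x by (simp add: at_within_Icc_at b_def)
  then show ?thesis by (simp add: dx_def DERIV_imp_deriv)
qed

lemma dx_cong: "(\<And>x y. x > 0 \<Longrightarrow> y > 0 \<Longrightarrow> f x y = g x y) \<Longrightarrow> x > 0 \<Longrightarrow> y > 0 \<Longrightarrow> dx f x y = dx g x y"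
  unfolding dx_def
  by (intro deriv_cong_ev refl eventually_nhds_in_open[of "{0<..}", THEN eventually_mono]) auto

lemma mixed_partial_0_0 [simp]: "mixed_partial 0 0 f = f"
  by (simp add: mixed_partial_def)

lemma mixed_partial_Suc_left: "mixed_partial (Suc a) b f = dx (mixed_partial a b f)"
  by (simp add: mixed_partial_def)

lemma smooth_mixed_partial: "smooth_quadrant f \<Longrightarrow> smooth_quadrant (mixed_partial a b f)"
  unfolding mixed_partial_def
  by (induction a; induction b) (simp_all add: smooth_quadrantD)

text \<open>\<open>mixed_partial\<close> takes the y-derivatives first, so a further
  \<open>dy\<close> has to pass \<open>a\<close> x-derivatives, one application of Schwarz at a
  time. The equations hold on the quadrant only; as it is open, \<open>dx_cong\<close> may still
  differentiate them.\<close>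

lemma dy_mixed_partial:
  assumes "smooth_quadrant f" "x > 0" "y > 0"
  shows "dy (mixed_partial a b f) x y = mixed_partial a (Suc b) f x y"
  using assms(2,3)
proof (induction a arbitrary: x y)
  case (Suc a)
  have s: "smooth_quadrant (mixed_partial a b f)" by (rule smooth_mixed_partial[OF assms(1)])
  have "dy (mixed_partial (Suc a) b f) x y = dx (dy (mixed_partial a b f)) x y"
    unfolding mixed_partial_Suc_left using s Suc.prems
    by (intro dx_dy_commute[symmetric]) (auto intro: smooth_quadrantD)
  also have "\<dots> = mixed_partial (Suc a) (Suc b) f x y"
    unfolding mixed_partial_Suc_left using Suc by (intro dx_cong) auto
  finally show ?case .
qed (simp add: mixed_partial_def)

lemma mixed_partial_has_derivative:
  assumes "smooth_quadrant f" "x > 0" "y > 0"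
  shows "((\<lambda>p. mixed_partial a b f (fst p) (snd p)) has_derivative
     (\<lambda>h. mixed_partial (Suc a) b f x y * fst h + mixed_partial a (Suc b) f x y * snd h)) (at (x, y))"
  unfolding mixed_partial_Suc_left dy_mixed_partial[OF assms, symmetric]
  using smooth_quadrantD(1)[OF smooth_mixed_partial[OF assms(1)], of a b] assms(2,3)
  unfolding total_diff_def has_partials_def by blast

subsection \<open>Taylor expansion along a segment\<close>

text \<open>Pascal's rule: the step from the n-th to the next power of the operator h d/dx + v d/dy,
  with \<open>D a b\<close> standing for the partial derivative of orders a and b.\<close>

lemma binomial_derivative_sum:
  fixes D :: "nat \<Rightarrow> nat \<Rightarrow> real"
  shows "(\<Sum>k\<le>n. real (n choose k) * h ^ (n - k) * v ^ k * (h * D (Suc (n - k)) k + v * D (n - k) (Suc k)))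
    = (\<Sum>k\<le>Suc n. real (Suc n choose k) * h ^ (Suc n - k) * v ^ k * D (Suc n - k) k)"
proof -
  define t where "t k = h ^ (Suc n - k) * v ^ k * D (Suc n - k) k" for k
  have "(\<Sum>k\<le>Suc n. real (Suc n choose k) * t k) =
      (\<Sum>k\<le>n. real (n choose k) * t (Suc k)) + (t 0 + (\<Sum>k\<le>n. real (n choose Suc k) * t (Suc k)))"
    by (subst sum.atMost_Suc_shift) (simp add: algebra_simps sum.distrib)
  also have "t 0 + (\<Sum>k\<le>n. real (n choose Suc k) * t (Suc k)) = (\<Sum>k\<le>Suc n. real (n choose k) * t k)"
    by (subst sum.atMost_Suc_shift) simp
  also have "(\<Sum>k\<le>Suc n. real (n choose k) * t k) = (\<Sum>k\<le>n. real (n choose k) * t k)" by simp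
  finally have *: "(\<Sum>k\<le>Suc n. real (Suc n choose k) * t k) =
      (\<Sum>k\<le>n. real (n choose k) * (t k + t (Suc k)))"
    by (simp add: algebra_simps sum.distrib)
  have "(\<Sum>k\<le>n. real (n choose k) * h ^ (n - k) * v ^ k * (h * D (Suc (n - k)) k + v * D (n - k) (Suc k)))
      = (\<Sum>k\<le>n. real (n choose k) * (t k + t (Suc k)))"
    by (intro sum.cong refl) (auto simp: t_def Suc_diff_le algebra_simps)
  also note *[symmetric]
  finally show ?thesis by (simp only: t_def mult.assoc)
qed

text \<open>The one-variable Taylor formula for \<open>f\<close> restricted to the segment, which
  stays in the quadrant by convexity. Each derivative in \<open>u\<close> applies h d/dx + v d/dy
  once more.\<close>

lemma taylor_quadrant:
  assumes f: "smooth_quadrant f"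
    and pos: "x0 > 0" "y0 > 0" "x1 > 0" "y1 > 0"
  defines "h \<equiv> x1 - x0" and "v \<equiv> y1 - y0"
  shows "f x1 y1 =
    (\<Sum>n\<le>N. 1 / fact n * (\<Sum>k\<le>n. real (n choose k) * h ^ (n - k) * v ^ k * mixed_partial (n - k) k f x0 y0))
    + 1 / fact N * (\<Sum>k\<le>Suc N. real (Suc N choose k) * h ^ (Suc N - k) * v ^ k *
        (LBINT u=0..1. (1 - u) ^ N * mixed_partial (Suc N - k) k f ((1 - u) * x0 + u * x1) ((1 - u) * y0 + u * y1)))"
proof -
  define X where "X u = (1 - u) * x0 + u * x1" for u
  define Y where "Y u = (1 - u) * y0 + u * y1" for u
  have XY: "X u > 0" "Y u > 0" if "u \<in> {0..1}" for u
    using that pos unfolding X_def Y_def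
    by (cases "u = 0"; auto intro!: add_nonneg_pos)+
  define Df where "Df n u = (\<Sum>k\<le>n. real (n choose k) * h ^ (n - k) * v ^ k * mixed_partial (n - k) k f (X u) (Y u))"
    for n u
  have dD: "((\<lambda>u. mixed_partial a b f (X u) (Y u)) has_real_derivative
      (h * mixed_partial (Suc a) b f (X u) (Y u) + v * mixed_partial a (Suc b) f (X u) (Y u))) (at u within {0..1})"
    if "u \<in> {0..1}" for a b u
  proof -
    have 1: "((\<lambda>u. (X u, Y u)) has_derivative (\<lambda>t. (t * h, t * v))) (at u within {0..1})"
      unfolding X_def Y_def h_def v_def by (auto intro!: derivative_eq_intros simp: algebra_simps)
    show ?thesis
      unfolding has_field_derivative_def
      by (rule has_derivative_eq_rhs, rule has_derivative_compose[OF 1 mixed_partial_has_derivative[OF f XY[OF that], of a b],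
            unfolded fst_conv snd_conv]) (simp add: fun_eq_iff algebra_simps)
  qed
  have der: "(Df n has_vector_derivative Df (Suc n) u) (at u within {0..1})" if "u \<in> {0..1}" for n u
  proof -
    have "(Df n has_real_derivative (\<Sum>k\<le>n. real (n choose k) * h ^ (n - k) * v ^ k *
       (h * mixed_partial (Suc (n - k)) k f (X u) (Y u) + v * mixed_partial (n - k) (Suc k) f (X u) (Y u))))
       (at u within {0..1})"
      unfolding Df_def by (intro DERIV_sum DERIV_cmult dD that)
    also have "(\<Sum>k\<le>n. real (n choose k) * h ^ (n - k) * v ^ k *
       (h * mixed_partial (Suc (n - k)) k f (X u) (Y u) + v * mixed_partial (n - k) (Suc k) f (X u) (Y u)))
       = Df (Suc n) u"
      unfolding Df_def by (rule binomial_derivative_sum)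
    finally show ?thesis by (simp add: has_real_derivative_iff_has_vector_derivative)
  qed
  have cont: "continuous_on {0..1} (\<lambda>u. mixed_partial a b f (X u) (Y u))" for a b
  proof (rule total_diff_continuous_on_compose[OF smooth_quadrantD(1)[OF smooth_mixed_partial[OF f]]])
    show "continuous_on {0..1} X" "continuous_on {0..1} Y"
      unfolding X_def Y_def by (intro continuous_intros)+
  qed (use XY in auto)
  have taylor: "Df 0 1 = (\<Sum>i<Suc N. ((1 - 0) ^ i / fact i) *\<^sub>R Df i 0) +
      integral {0..1} (\<lambda>u. ((1 - u) ^ (Suc N - 1) / fact (Suc N - 1)) *\<^sub>R Df (Suc N) u)"
    by (rule Taylor_integral) (auto intro: der)
  have "integral {0..1} (\<lambda>u. ((1 - u) ^ (Suc N - 1) / fact (Suc N - 1)) *\<^sub>R Df (Suc N) u)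
      = integral {0..1} (\<lambda>u. 1 / fact N * (\<Sum>k\<le>Suc N. real (Suc N choose k) * h ^ (Suc N - k) * v ^ k *
          ((1 - u) ^ N * mixed_partial (Suc N - k) k f (X u) (Y u))))"
    unfolding Df_def by (intro integral_cong) (simp add: sum_distrib_left mult_ac del: sum.atMost_Suc binomial_Suc_Suc)
  also have "\<dots> = 1 / fact N * (\<Sum>k\<le>Suc N. real (Suc N choose k) * h ^ (Suc N - k) * v ^ k *
          integral {0..1} (\<lambda>u. (1 - u) ^ N * mixed_partial (Suc N - k) k f (X u) (Y u)))"
    unfolding integral_mult_right
    by (subst integral_sum)
      (auto intro!: integrable_continuous_interval continuous_intros cont simp del: sum.atMost_Suc binomial_Suc_Suc)
  also have "\<dots> = 1 / fact N * (\<Sum>k\<le>Suc N. real (Suc N choose k) * h ^ (Suc N - k) * v ^ k *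
          (LBINT u=0..1. (1 - u) ^ N * mixed_partial (Suc N - k) k f (X u) (Y u)))"
  proof -
    have "integral {0..1} (\<lambda>u. (1 - u) ^ N * mixed_partial a k f (X u) (Y u)) =
        (LBINT u=0..1. (1 - u) ^ N * mixed_partial a k f (X u) (Y u))" for a k
      using interval_integral_eq_integral[of 0 1 "\<lambda>u. (1 - u) ^ N * mixed_partial a k f (X u) (Y u)"]
      by (simp add: zero_ereal_def one_ereal_def borel_integrable_atLeastAtMost' cont continuous_intros)
    then show ?thesis by simp
  qed
  finally have "f x1 y1 = (\<Sum>i<Suc N. (1 / fact i) * Df i 0) + 1 / fact N * (\<Sum>k\<le>Suc N. real (Suc N choose k) * h ^ (Suc N - k) * v ^ k *
          (LBINT u=0..1. (1 - u) ^ N * mixed_partial (Suc N - k) k f (X u) (Y u)))"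
    using taylor by (simp add: Df_def X_def Y_def del: sum.atMost_Suc binomial_Suc_Suc sum.lessThan_Suc)
  then show ?thesis
    unfolding lessThan_Suc_atMost Df_def X_def Y_def by (simp del: sum.atMost_Suc binomial_Suc_Suc)
qed

subsection \<open>Partial derivatives of the Black--Scholes put price\<close>

text \<open>From 1 + t \<le> exp t, and then by completing the square: i * t - t^2 / 2 is at most
  i^2 / 2.\<close>

lemma one_plus_abs_power_gauss_le: "(1 + \<bar>u\<bar>) ^ i * exp (- u\<^sup>2 / 2) \<le> exp ((real i)\<^sup>2 / 2)"
proof -
  have "(1 + \<bar>u\<bar>) ^ i \<le> exp \<bar>u\<bar> ^ i"
    by (intro power_mono exp_ge_add_one_self) auto
  also have "\<dots> = exp (real i * \<bar>u\<bar>)"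
    by (simp add: exp_of_nat_mult)
  finally have "(1 + \<bar>u\<bar>) ^ i * exp (- u\<^sup>2 / 2) \<le> exp (real i * \<bar>u\<bar>) * exp (- u\<^sup>2 / 2)"
    by (intro mult_right_mono) auto
  also have "\<dots> = exp (real i * \<bar>u\<bar> - u\<^sup>2 / 2)"
    by (simp flip: exp_add)
  also have "\<dots> \<le> exp ((real i)\<^sup>2 / 2)"
    using sum_squares_ge_zero[of "real i - \<bar>u\<bar>" 0] by (simp add: power2_eq_square algebra_simps)
  finally show ?thesis .
qed

lemma inverse_sqrt_has_derivative:
  assumes "y > 0"
  shows "((\<lambda>p. 1 / sqrt (snd p)) has_derivative (\<lambda>h. - ((1 / sqrt y) ^ 3 / 2) * snd h)) (at (x :: real, y))"
  using assms by (auto intro!: derivative_eq_intros simp: power3_eq_cube field_simps)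

text \<open>\<open>d_minus\<close> and \<open>q\<close> serve as variables: their derivatives are
  polynomials in \<open>1 / x\<close>, \<open>q\<close> and \<open>d_minus\<close>, so this shape
  persists under repeated differentiation.\<close>

lemma d_minus_has_derivative:
  assumes "K > 0" "x > 0" "y > 0"
  defines "q \<equiv> 1 / sqrt y"
  shows "((\<lambda>p. d_minus K r T (fst p) (snd p)) has_derivative
    (\<lambda>h. 1 / x * q * fst h - (d_minus K r T x y * q ^ 2 / 2 + q / 2) * snd h)) (at (x, y))"
proof -
  define c where "c = ln (x / K) + r * T - y / 2"
  have 1: "((\<lambda>p. ln (fst p / K) + r * T - snd p / 2) has_derivative (\<lambda>h. 1 / x * fst h - snd h / 2)) (at (x, y))"
    using assms by (auto intro!: derivative_eq_intros simp: field_simps)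
  have y: "y * q ^ 2 = 1" and d: "d_minus K r T x y = c * q"
    using assms by (auto simp: q_def power_divide d_minus_def c_def)
  have "((\<lambda>p. (ln (fst p / K) + r * T - snd p / 2) * (1 / sqrt (snd p))) has_derivative
      (\<lambda>h. 1 / x * q * fst h - (d_minus K r T x y * q ^ 2 / 2 + q / 2) * snd h)) (at (x, y))"
    by (rule has_derivative_eq_rhs, rule has_derivative_mult[OF 1 inverse_sqrt_has_derivative[OF \<open>y > 0\<close>]])
      (simp add: d fun_eq_iff flip: q_def c_def; simp add: algebra_simps power2_eq_square power3_eq_cube)
  then show ?thesis by (simp add: d_minus_def)
qed

section \<open>A family of functions closed under both partial derivatives\<close>

locale black_scholes =
  fixes K r T :: real
  assumes K_pos: "K > 0"
begin

abbreviation "dm \<equiv> d_minus K r T"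

text \<open>Up to constants all higher derivatives of the put price are combinations of these monomials;
  the constraint \<open>i \<le> j\<close> in \<open>bs_span\<close> keeps them bounded as \<open>y \<longrightarrow> \<infinity>\<close>.\<close>
definition bs_monom :: "nat \<Rightarrow> nat \<Rightarrow> nat \<Rightarrow> real \<Rightarrow> real \<Rightarrow> real" where
  "bs_monom a i j x y = (1 / x) ^ a * exp (- (dm x y)\<^sup>2 / 2) * dm x y ^ i * (1 / sqrt y) ^ j"

inductive bs_span :: "nat \<Rightarrow> (real \<Rightarrow> real \<Rightarrow> real) \<Rightarrow> bool" where
  span_monom: "i \<le> j \<Longrightarrow> bs_span a (bs_monom a i j)"
| span_add: "bs_span a f \<Longrightarrow> bs_span a g \<Longrightarrow> bs_span a (\<lambda>x y. f x y + g x y)"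
| span_scale: "bs_span a f \<Longrightarrow> bs_span a (\<lambda>x y. c * f x y)"
| span_cong: "bs_span a f \<Longrightarrow> (\<And>x y. x > 0 \<Longrightarrow> y > 0 \<Longrightarrow> g x y = f x y) \<Longrightarrow> bs_span a g"

text \<open>The product rule on four factors. An x-derivative adds exactly one to \<open>a\<close>,
  a y-derivative leaves it alone, and no summand raises \<open>i\<close> by more than
  \<open>j\<close>, which preserves the constraint \<open>i \<le> j\<close>.\<close>

lemma bs_monom_has_derivative:
  fixes a i j :: nat
  assumes xy: "x > 0" "y > 0"
  defines "fx \<equiv> \<lambda>x y. (- real a) * bs_monom (Suc a) i j x y + (- 1) * bs_monom (Suc a) (Suc i) (Suc j) x y
      + real i * bs_monom (Suc a) (i - 1) (Suc j) x y"
    and "fy \<equiv> \<lambda>x y. (1/2) * bs_monom a (i + 2) (j + 2) x y + (1/2) * bs_monom a (i + 1) (j + 1) x y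
      + (- real i / 2) * bs_monom a i (j + 2) x y + (- real i / 2) * bs_monom a (i - 1) (j + 1) x y
      + (- real j / 2) * bs_monom a i (j + 2) x y"
  shows "((\<lambda>p. bs_monom a i j (fst p) (snd p)) has_derivative (\<lambda>h. fx x y * fst h + fy x y * snd h)) (at (x, y))"
proof -
  define X where "X = 1 / x"
  define q where "q = 1 / sqrt y"
  define d where "d = dm x y"
  define e where "e = exp (- d\<^sup>2 / 2)"
  have dq: "((\<lambda>p. 1 / sqrt (snd p)) has_derivative (\<lambda>h. - (q ^ 3 / 2) * snd h)) (at (x, y))"
    unfolding q_def by (rule inverse_sqrt_has_derivative[OF xy(2)])
  have dX: "((\<lambda>p. 1 / fst p) has_derivative (\<lambda>h. - (X ^ 2) * fst h)) (at (x, y))"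
    using xy by (auto intro!: derivative_eq_intros simp: X_def power2_eq_square field_simps)
  have dd: "((\<lambda>p. dm (fst p) (snd p)) has_derivative
    (\<lambda>h. X * q * fst h - (d * q ^ 2 / 2 + q / 2) * snd h)) (at (x, y))"
    unfolding X_def q_def d_def by (rule d_minus_has_derivative[OF K_pos xy])
  have de: "((\<lambda>p. exp (- (dm (fst p) (snd p))\<^sup>2 / 2)) has_derivative
    (\<lambda>h. - d * e * (X * q * fst h - (d * q ^ 2 / 2 + q / 2) * snd h))) (at (x, y))"
  proof -
    have "((\<lambda>p. (dm (fst p) (snd p))\<^sup>2) has_derivative
      (\<lambda>h. 2 * d * (X * q * fst h - (d * q ^ 2 / 2 + q / 2) * snd h))) (at (x, y))"
      by (rule has_derivative_eq_rhs, rule has_derivative_power[OF dd]) (simp add: fun_eq_iff flip: d_def)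
    from has_derivative_exp[OF has_derivative_mult_right[OF this, of "- 1 / 2"]]
    have "((\<lambda>p. exp (- 1 / 2 * (dm (fst p) (snd p))\<^sup>2)) has_derivative
      (\<lambda>h. - d * e * (X * q * fst h - (d * q ^ 2 / 2 + q / 2) * snd h))) (at (x, y))"
      by (rule has_derivative_eq_rhs) (simp add: fun_eq_iff e_def flip: d_def)
    then show ?thesis by simp
  qed
  have dXa: "((\<lambda>p. (1 / fst p) ^ a) has_derivative (\<lambda>h. - real a * X ^ (a + 1) * fst h)) (at (x, y))"
    by (rule derivative_eq_intros dX refl)+
      (cases a; simp add: fun_eq_iff algebra_simps power2_eq_square flip: X_def)
  have dqj: "((\<lambda>p. (1 / sqrt (snd p)) ^ j) has_derivative (\<lambda>h. - real j / 2 * q ^ (j + 2) * snd h)) (at (x, y))"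
    by (rule derivative_eq_intros dq refl)+
      (cases j; simp add: fun_eq_iff algebra_simps power3_eq_cube flip: q_def)
  have ddi: "((\<lambda>p. dm (fst p) (snd p) ^ i) has_derivative
     (\<lambda>h. real i * d ^ (i - 1) * (X * q * fst h - (d * q ^ 2 / 2 + q / 2) * snd h))) (at (x, y))"
    by (rule derivative_eq_intros dd refl)+ (simp add: fun_eq_iff flip: d_def)
  \<comment> \<open>For \<open>i = 0\<close> the truncated difference \<open>i - 1\<close> is
    harmless, as the factor \<open>real i\<close> vanishes.\<close>
  have i: "real i * d ^ i = real i * d ^ (i - 1) * d"
    by (cases i) auto
  show ?thesis
    unfolding bs_monom_def
  proof (rule has_derivative_eq_rhs)
    show "((\<lambda>p. (1 / fst p) ^ a * exp (- (dm (fst p) (snd p))\<^sup>2 / 2) * dm (fst p) (snd p) ^ i * (1 / sqrt (snd p)) ^ j)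
      has_derivative (\<lambda>h. X ^ a * e * d ^ i * (- real j / 2 * q ^ (j + 2) * snd h) +
        (X ^ a * e * (real i * d ^ (i - 1) * (X * q * fst h - (d * q ^ 2 / 2 + q / 2) * snd h)) +
         (X ^ a * (- d * e * (X * q * fst h - (d * q ^ 2 / 2 + q / 2) * snd h)) +
          (- real a * X ^ (a + 1) * fst h) * e) * d ^ i) * q ^ j)) (at (x, y))"
      by (rule has_derivative_eq_rhs,
          rule has_derivative_mult[OF has_derivative_mult[OF has_derivative_mult[OF dXa de] ddi] dqj])
        (simp add: X_def q_def d_def e_def)
    \<comment> \<open>\<open>D\<close> stands for \<open>real i * d ^ (i - 1)\<close>, which leaves
      a polynomial identity; \<open>D * d\<close> is read as \<open>real i * d ^ i\<close>
      afterwards.\<close>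
    have *: "X ^ a * e * d ^ i * (- real j / 2 * q ^ (j + 2) * v) +
        (X ^ a * e * (D * (X * q * u - (d * q ^ 2 / 2 + q / 2) * v)) +
         (X ^ a * (- d * e * (X * q * u - (d * q ^ 2 / 2 + q / 2) * v)) +
          (- real a * X ^ (a + 1) * u) * e) * d ^ i) * q ^ j
      = ((- real a) * (X ^ Suc a * e * d ^ i * q ^ j) + (- 1) * (X ^ Suc a * e * d ^ Suc i * q ^ Suc j)
          + (X ^ Suc a * e * D * q ^ Suc j)) * u
        + ((1/2) * (X ^ a * e * d ^ (i + 2) * q ^ (j + 2)) + (1/2) * (X ^ a * e * d ^ (i + 1) * q ^ (j + 1))
          + (- 1 / 2) * (X ^ a * e * (D * d) * q ^ (j + 2)) + (- 1 / 2) * (X ^ a * e * D * q ^ (j + 1))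
          + (- real j / 2) * (X ^ a * e * d ^ i * q ^ (j + 2))) * v" for D u v
      by (simp add: algebra_simps power2_eq_square)
    show "(\<lambda>h. X ^ a * e * d ^ i * (- real j / 2 * q ^ (j + 2) * snd h) +
        (X ^ a * e * (real i * d ^ (i - 1) * (X * q * fst h - (d * q ^ 2 / 2 + q / 2) * snd h)) +
         (X ^ a * (- d * e * (X * q * fst h - (d * q ^ 2 / 2 + q / 2) * snd h)) +
          (- real a * X ^ (a + 1) * fst h) * e) * d ^ i) * q ^ j) = (\<lambda>h. fx x y * fst h + fy x y * snd h)"
      unfolding * fx_def fy_def bs_monom_def i[symmetric] X_def[symmetric] q_def[symmetric] d_def[symmetric] e_def[symmetric]
      by (simp add: fun_eq_iff algebra_simps)
  qed
qed

lemma bs_span_has_partials: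
  assumes "bs_span a f"
  shows "\<exists>fx fy. bs_span (Suc a) fx \<and> bs_span a fy \<and> has_partials f fx fy"
  using assms
proof (induction rule: bs_span.induct)
  case (span_monom i j a)
  define fx where "fx = (\<lambda>x y. (- real a) * bs_monom (Suc a) i j x y + (- 1) * bs_monom (Suc a) (Suc i) (Suc j) x y
      + real i * bs_monom (Suc a) (i - 1) (Suc j) x y)"
  define fy where "fy = (\<lambda>x y. (1/2) * bs_monom a (i + 2) (j + 2) x y + (1/2) * bs_monom a (i + 1) (j + 1) x y
      + (- real i / 2) * bs_monom a i (j + 2) x y + (- real i / 2) * bs_monom a (i - 1) (j + 1) x y
      + (- real j / 2) * bs_monom a i (j + 2) x y)"
  have "bs_span (Suc a) fx" "bs_span a fy"
    unfolding fx_def fy_def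
    by (intro bs_span.span_add bs_span.span_scale bs_span.span_monom; use span_monom in simp)+
  moreover have "has_partials (bs_monom a i j) fx fy"
    unfolding fx_def fy_def by (rule has_partialsI, rule bs_monom_has_derivative)
  ultimately show ?case by blast
next
  case (span_add a f g)
  then obtain fx fy gx gy where
    "bs_span (Suc a) fx" "bs_span a fy" "bs_span (Suc a) gx" "bs_span a gy" and
    f: "has_partials f fx fy" and g: "has_partials g gx gy"
    by blast
  moreover have "has_partials (\<lambda>x y. f x y + g x y) (\<lambda>x y. fx x y + gx x y) (\<lambda>x y. fy x y + gy x y)"
    by (rule has_partialsI, rule has_derivative_eq_rhs,
        rule has_derivative_add[OF has_partialsD[OF f] has_partialsD[OF g]]) (auto simp: algebra_simps)
  ultimately show ?case by (blast intro: bs_span.span_add)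
next
  case (span_scale a f c)
  then obtain fx fy where "bs_span (Suc a) fx" "bs_span a fy" and f: "has_partials f fx fy"
    by blast
  moreover have "has_partials (\<lambda>x y. c * f x y) (\<lambda>x y. c * fx x y) (\<lambda>x y. c * fy x y)"
    by (rule has_partialsI, rule has_derivative_eq_rhs, rule has_derivative_mult_right[OF has_partialsD[OF f]])
      (auto simp: algebra_simps)
  ultimately show ?case by (blast intro: bs_span.span_scale)
next
  case (span_cong a f g)
  then obtain fx fy where "bs_span (Suc a) fx" "bs_span a fy" and f: "has_partials f fx fy"
    by blast
  moreover have "has_partials g fx fy"
    by (rule has_partialsI, rule has_derivative_cong_quadrant[OF has_partialsD[OF f] span_cong(2)])
  ultimately show ?case by blast
qed

text \<open>The explicit derivatives are correct on the quadrant only; \<open>span_cong\<close>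
  passes from them to \<open>dx f\<close> and \<open>dy f\<close> themselves.\<close>

lemma bs_span_partials:
  assumes "bs_span a f"
  shows "bs_span (Suc a) (dx f)" "bs_span a (dy f)" "total_diff f"
proof -
  from bs_span_has_partials[OF assms] obtain fx fy where *: "bs_span (Suc a) fx" "bs_span a fy"
    and f: "has_partials f fx fy"
    by blast
  note eq = dx_dy_eqI[OF has_partialsD[OF f]]
  show "bs_span (Suc a) (dx f)" by (rule bs_span.span_cong[OF *(1) eq(1)])
  show "bs_span a (dy f)" by (rule bs_span.span_cong[OF *(2) eq(2)])
  show "total_diff f"
    unfolding total_diff_def
    by (rule has_partialsI, unfold eq) (rule has_partialsD[OF f])
qed

lemma bs_span_smooth: "bs_span a f \<Longrightarrow> smooth_quadrant f"
proof (coinduction arbitrary: a f)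
  case smooth_quadrant
  then show ?case using bs_span_partials by blast
qed

text \<open>The squares of \<open>d_plus\<close> and \<open>d_minus\<close> differ by twice ln (x /
  K) + r * T. This is the classical relation between the normal densities at the two points; it
  causes the cancellation in the first derivatives and supplies the factor \<open>x\<close> in the
  growth bound.\<close>

lemma dm_squared_shift:
  assumes "x > 0" "y > 0"
  shows "exp (- (dm x y)\<^sup>2 / 2) = exp (r * T) / K * x * exp (- (d_plus K r T x y)\<^sup>2 / 2)"
    and "d_plus K r T x y = dm x y + sqrt y"
proof -
  have y: "sqrt y * sqrt y = y" "sqrt y > 0" using assms by auto
  show dp: "d_plus K r T x y = dm x y + sqrt y"
    using y by (simp add: d_plus_def d_minus_def field_simps)
  have "dm x y * sqrt y = ln (x / K) + r * T - y / 2"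
    using y by (simp add: d_minus_def)
  then have "(d_plus K r T x y)\<^sup>2 / 2 = (dm x y)\<^sup>2 / 2 + (ln (x / K) + r * T)"
    using y unfolding dp by (simp add: power2_eq_square algebra_simps)
  then have "- (dm x y)\<^sup>2 / 2 = (ln (x / K) + r * T) + - (d_plus K r T x y)\<^sup>2 / 2"
    by linarith
  then have "exp (- (dm x y)\<^sup>2 / 2) = exp (ln (x / K)) * exp (r * T) * exp (- (d_plus K r T x y)\<^sup>2 / 2)"
    by (simp only: exp_add)
  then show "exp (- (dm x y)\<^sup>2 / 2) = exp (r * T) / K * x * exp (- (d_plus K r T x y)\<^sup>2 / 2)"
    using assms K_pos by simp
qed

text \<open>Two bounds in one: the Gaussian in d_- gives a constant, and rewriting it as
  \<open>x\<close> times the Gaussian in d_+ gives a multiple of \<open>x\<close>. Both are used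
  later, the constant for \<open>a = 0\<close>, the other to cancel one power of \<open>x\<close>
  for \<open>a \<ge> 1\<close>.\<close>

lemma bs_monom_bound:
  assumes "i \<le> j" "\<delta> > 0"
  shows "\<exists>C\<ge>0. \<forall>x>0. \<forall>y\<ge>\<delta>. \<bar>bs_monom a i j x y\<bar> * x ^ a \<le> C * min 1 x"
proof -
  \<comment> \<open>\<open>c\<close> bounds \<open>1 / sqrt y\<close> for
    \<open>y \<ge> \<delta>\<close>; being at least 1, it also absorbs the constant in the estimate
    of \<open>u * q - 1\<close>.\<close>
  define c where "c = max 1 (1 / sqrt \<delta>)"
  have c: "c \<ge> 1" by (simp add: c_def)
  define A where "A = exp (r * T) / K"
  have A: "A > 0" using K_pos by (simp add: A_def)
  define C where "C = max 1 A * (c ^ j * exp ((real i)\<^sup>2 / 2))"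
  have "\<bar>bs_monom a i j x y\<bar> * x ^ a \<le> C * min 1 x" if xy: "x > 0" "y \<ge> \<delta>" for x y
  proof -
    define q where "q = 1 / sqrt y"
    have y: "y > 0" using xy assms by simp
    have q: "q > 0" "q \<le> c"
      using xy y assms by (auto simp: q_def c_def frac_le intro!: max.coboundedI2)
    have m: "\<bar>bs_monom a i j x y\<bar> * x ^ a = exp (- (dm x y)\<^sup>2 / 2) * \<bar>dm x y\<bar> ^ i * q ^ j"
      using xy q(1) unfolding bs_monom_def q_def[symmetric]
      by (simp add: abs_mult power_abs power_one_over)
    have "\<bar>dm x y\<bar> ^ i * exp (- (dm x y)\<^sup>2 / 2) \<le> (1 + \<bar>dm x y\<bar>) ^ i * exp (- (dm x y)\<^sup>2 / 2)"
      by (intro mult_right_mono power_mono) auto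
    also have "\<dots> \<le> exp ((real i)\<^sup>2 / 2)" by (rule one_plus_abs_power_gauss_le)
    finally have "exp (- (dm x y)\<^sup>2 / 2) * \<bar>dm x y\<bar> ^ i * q ^ j \<le> exp ((real i)\<^sup>2 / 2) * c ^ j"
      using q by (intro mult_mono power_mono) (auto simp: mult_ac)
    also have "\<dots> \<le> C"
      unfolding C_def using c by (simp add: mult_ac mult_le_cancel_left1)
    finally have 1: "\<bar>bs_monom a i j x y\<bar> * x ^ a \<le> C" unfolding m .
    \<comment> \<open>For fixed \<open>u\<close> and large \<open>y\<close>, \<open>dm\<close> grows
      like \<open>sqrt y\<close>. By \<open>i \<le> j\<close> every factor \<open>dm\<close> can be
      paired with a factor \<open>q\<close>, and \<open>dm * q = u * q - 1\<close> stays under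
      control.\<close>
    define u where "u = d_plus K r T x y"
    have u: "dm x y = u - sqrt y" using dm_squared_shift(2)[OF xy(1) y] by (simp add: u_def)
    have qy: "sqrt y * q = 1" using y by (simp add: q_def)
    have "\<bar>dm x y\<bar> ^ i * q ^ i = \<bar>u * q - 1\<bar> ^ i"
      unfolding u using q by (simp add: left_diff_distrib qy abs_mult flip: power_mult_distrib)
        (metis abs_mult abs_of_pos left_diff_distrib q(1) qy)
    also have "\<dots> \<le> (c * (1 + \<bar>u\<bar>)) ^ i"
    proof (rule power_mono)
      have "\<bar>u * q - 1\<bar> \<le> \<bar>u\<bar> * q + 1"
        using abs_triangle_ineq4[of "u * q" 1] q(1) by (simp add: abs_mult)
      also have "\<dots> \<le> \<bar>u\<bar> * c + c" using q c by (intro add_mono mult_left_mono) auto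
      finally show "\<bar>u * q - 1\<bar> \<le> c * (1 + \<bar>u\<bar>)" by (simp add: algebra_simps)
    qed auto
    finally have "\<bar>dm x y\<bar> ^ i * q ^ i * q ^ (j - i) \<le> (c * (1 + \<bar>u\<bar>)) ^ i * c ^ (j - i)"
      using q c by (intro mult_mono power_mono) auto
    moreover have "t ^ j = t ^ i * t ^ (j - i)" for t :: real
      using \<open>i \<le> j\<close> by (simp flip: power_add)
    ultimately have "\<bar>dm x y\<bar> ^ i * q ^ j \<le> c ^ j * (1 + \<bar>u\<bar>) ^ i"
      by (simp only: power_mult_distrib mult_ac)
    then have "exp (- (dm x y)\<^sup>2 / 2) * (\<bar>dm x y\<bar> ^ i * q ^ j)
        \<le> A * x * exp (- u\<^sup>2 / 2) * (c ^ j * (1 + \<bar>u\<bar>) ^ i)"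
      unfolding dm_squared_shift(1)[OF xy(1) y] A_def u_def using xy K_pos
      by (intro mult_left_mono) auto
    also have "\<dots> = A * x * (c ^ j * ((1 + \<bar>u\<bar>) ^ i * exp (- u\<^sup>2 / 2)))" by simp
    also have "\<dots> \<le> A * x * (c ^ j * exp ((real i)\<^sup>2 / 2))"
      using A xy c by (intro mult_left_mono one_plus_abs_power_gauss_le) auto
    also have "\<dots> \<le> C * x"
      unfolding C_def using A xy c by (simp add: mult_ac mult_right_mono)
    finally have 2: "\<bar>bs_monom a i j x y\<bar> * x ^ a \<le> C * x" unfolding m by (simp add: mult_ac)
    show ?thesis using 1 2 by (auto simp: min_def)
  qed
  moreover have "C \<ge> 0" using c by (simp add: C_def)
  ultimately show ?thesis by blast
qed

lemma bs_span_bound: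
  assumes "bs_span a f" and \<delta>: "\<delta> > 0"
  shows "\<exists>C\<ge>0. \<forall>x>0. \<forall>y\<ge>\<delta>. \<bar>f x y\<bar> * x ^ a \<le> C * min 1 x"
  using assms(1)
proof (induction rule: bs_span.induct)
  case (span_monom i j a)
  then show ?case by (rule bs_monom_bound[OF _ \<delta>])
next
  case (span_add a f g)
  then obtain C D where CD: "C \<ge> 0" "D \<ge> 0"
    "\<forall>x>0. \<forall>y\<ge>\<delta>. \<bar>f x y\<bar> * x ^ a \<le> C * min 1 x" "\<forall>x>0. \<forall>y\<ge>\<delta>. \<bar>g x y\<bar> * x ^ a \<le> D * min 1 x" by blast
  have "\<bar>f x y + g x y\<bar> * x ^ a \<le> (C + D) * min 1 x" if "x > 0" "y \<ge> \<delta>" for x y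
  proof -
    have "\<bar>f x y + g x y\<bar> * x ^ a \<le> (\<bar>f x y\<bar> + \<bar>g x y\<bar>) * x ^ a"
      using that by (intro mult_right_mono) auto
    also have "\<dots> \<le> C * min 1 x + D * min 1 x"
      using CD(3,4) that by (simp add: distrib_right add_mono)
    finally show ?thesis by (simp add: distrib_right)
  qed
  then show ?case using CD(1,2) by (intro exI[of _ "C + D"]) auto
next
  case (span_scale a f c)
  then obtain C where C: "C \<ge> 0" "\<forall>x>0. \<forall>y\<ge>\<delta>. \<bar>f x y\<bar> * x ^ a \<le> C * min 1 x" by blast
  have "\<bar>c * f x y\<bar> * x ^ a \<le> (\<bar>c\<bar> * C) * min 1 x" if "x > 0" "y \<ge> \<delta>" for x y
    using C(2) that mult_left_mono[of "\<bar>f x y\<bar> * x ^ a" "C * min 1 x" "\<bar>c\<bar>"] by (simp add: abs_mult mult_ac)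
  then show ?case using C(1) by (intro exI[of _ "\<bar>c\<bar> * C"]) auto
next
  case (span_cong a f g)
  then obtain C where "C \<ge> 0" "\<forall>x>0. \<forall>y\<ge>\<delta>. \<bar>f x y\<bar> * x ^ a \<le> C * min 1 x" by blast
  with span_cong(2) show ?case
    using \<delta> by (intro exI[of _ C]) (auto simp: less_le_trans)
qed

end

section \<open>The normal distribution function and the first derivatives of the put price\<close>

lemma Phi_eq_integral: "Phi x = (LINT z|lborel. indicator {..x} z * std_normal_density z)"
proof -
  have "Phi x = (LINT z|density lborel std_normal_density. indicator {..x} z)"
    by (simp add: Phi_def)
  also have "\<dots> = (LINT z|lborel. std_normal_density z * indicator {..x} z)"
    by (subst integral_density) auto
  finally show ?thesis by (simp add: mult.commute)
qed

lemma integrable_indicator_std_normal [simp]: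
  "integrable lborel (\<lambda>z. indicator {..x} z * std_normal_density z)"
  using integrable_mult_indicator[of "{..x}" lborel std_normal_density] by simp

lemma Phi_nonneg: "0 \<le> Phi x" and Phi_le_1: "Phi x \<le> 1"
proof -
  interpret prob_space "density lborel std_normal_density" by (rule prob_space_normal_density) simp
  show "0 \<le> Phi x" "Phi x \<le> 1" by (auto simp: Phi_def)
qed

lemma Phi_has_real_derivative: "(Phi has_real_derivative std_normal_density x) (at x)"
proof -
  have cont: "continuous_on A std_normal_density" for A
    unfolding std_normal_density_def[abs_def] by (intro continuous_intros) auto
  have "Phi t = Phi (x - 1) + integral {x - 1..t} std_normal_density" if t: "t \<in> {x - 1..x + 1}" for t
  proof -
    have "Phi t = (LINT z|lborel. indicator {..x - 1} z * std_normal_density z + indicator {x - 1<..t} z * std_normal_density z)"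
      unfolding Phi_eq_integral using t by (intro Bochner_Integration.integral_cong) (auto simp: indicator_def)
    also have "\<dots> = Phi (x - 1) + (LINT z|lborel. indicator {x - 1<..t} z * std_normal_density z)"
      unfolding Phi_eq_integral
      using integrable_mult_indicator[of "{x-1<..t}" lborel std_normal_density]
      by (intro Bochner_Integration.integral_add) auto
    also have "(LINT z|lborel. indicator {x - 1<..t} z * std_normal_density z) = (LINT z:{x - 1..t}|lborel. std_normal_density z)"
      unfolding set_lebesgue_integral_def
      by (intro integral_cong_AE) (auto intro!: AE_I[of _ _ "{x - 1}"] simp: indicator_def)
    also have "\<dots> = integral {x - 1..t} std_normal_density"
      by (intro set_borel_integral_eq_integral borel_integrable_atLeastAtMost' cont)
    finally show ?thesis .
  qed
  note * = this
  have "((\<lambda>t. Phi (x - 1) + integral {x - 1..t} std_normal_density) has_real_derivative 0 + std_normal_density x)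
      (at x within {x - 1..x + 1})"
    by (intro DERIV_add DERIV_const integral_has_real_derivative cont) auto
  then have "(Phi has_real_derivative std_normal_density x) (at x within {x - 1..x + 1})"
    by (intro has_field_derivative_transform_within[OF _ zero_less_one _ *[symmetric]]) auto
  then show ?thesis by (simp add: at_within_Icc_at)
qed

lemma Phi_has_derivative:
  assumes "(g has_derivative g') (at p)"
  shows "((\<lambda>p. Phi (g p)) has_derivative (\<lambda>h. std_normal_density (g p) * g' h)) (at p)"
  using has_derivative_compose[OF assms Phi_has_real_derivative[unfolded has_field_derivative_def]] .

context black_scholes
begin

definition c0 :: real where "c0 = K * exp (- r * T) / sqrt (2 * pi)"

lemma std_normal_density_dm:
  "K * exp (- r * T) * std_normal_density (- dm x y) = c0 * exp (- (dm x y)\<^sup>2 / 2)"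
  by (simp add: std_normal_density_def c0_def)

lemma std_normal_density_dp:
  assumes "x > 0" "y > 0"
  shows "std_normal_density (- d_plus K r T x y) = c0 * (1 / x) * exp (- (dm x y)\<^sup>2 / 2)"
  unfolding dm_squared_shift(1)[OF assms] c0_def std_normal_density_def
  using assms K_pos by (simp add: exp_minus field_simps)

lemma d_plus_has_derivative:
  assumes xy: "x > 0" "y > 0"
  shows "((\<lambda>p. d_plus K r T (fst p) (snd p)) has_derivative
    (\<lambda>h. 1 / x * (1 / sqrt y) * fst h + (- (dm x y * (1 / sqrt y) ^ 2 / 2)) * snd h)) (at (x, y))"
proof -
  have s: "((\<lambda>p. sqrt (snd p)) has_derivative (\<lambda>h. (1 / sqrt y) / 2 * snd h)) (at (x, y))"
    using xy by (auto intro!: derivative_eq_intros simp: field_simps)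
  have "((\<lambda>p. dm (fst p) (snd p) + sqrt (snd p)) has_derivative
    (\<lambda>h. 1 / x * (1 / sqrt y) * fst h + (- (dm x y * (1 / sqrt y) ^ 2 / 2)) * snd h)) (at (x, y))"
    by (rule has_derivative_eq_rhs, rule has_derivative_add[OF d_minus_has_derivative[OF K_pos xy] s])
      (simp add: fun_eq_iff algebra_simps)
  then show ?thesis
    by (rule has_derivative_cong_quadrant[where f="\<lambda>x y. dm x y + sqrt y"]) (use xy dm_squared_shift(2) in auto)
qed

text \<open>Delta and vega. By the density identity both \<open>Phi\<close>-terms carry the same
  factor \<open>E\<close>. The x-derivatives of d_- and d_+ agree and cancel; their y-derivatives
  differ by \<open>q / 2\<close>, and only this difference survives.\<close>

lemma BS_put_has_derivative:
  assumes xy: "x > 0" "y > 0"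
  shows "((\<lambda>p. BS_put K r T (fst p) (snd p)) has_derivative
    (\<lambda>h. - Phi (- d_plus K r T x y) * fst h + (c0 / 2 * bs_monom 0 0 1 x y) * snd h)) (at (x, y))"
proof -
  define q where "q = 1 / sqrt y"
  define X where "X = 1 / x"
  define d where "d = dm x y"
  define E where "E = c0 * exp (- d\<^sup>2 / 2)"
  have xX: "x * (E * X * D) = E * D" for D
    using xy by (simp add: X_def)
  have 1: "((\<lambda>p. K * exp (- r * T) * Phi (- dm (fst p) (snd p))) has_derivative
     (\<lambda>h. E * - (X * q * fst h - (d * q ^ 2 / 2 + q / 2) * snd h))) (at (x, y))"
    using has_derivative_mult_right[OF Phi_has_derivative[OF has_derivative_minus[OF d_minus_has_derivative[OF K_pos xy, of r T]]],
        of "K * exp (- r * T)"]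
    unfolding mult.assoc[symmetric, of "K * exp (- r * T)" "std_normal_density _"] std_normal_density_dm fst_conv snd_conv
    by (simp only: q_def X_def d_def E_def)
  have 2: "((\<lambda>p. Phi (- d_plus K r T (fst p) (snd p))) has_derivative
     (\<lambda>h. (E * X * - (X * q * fst h + (- (d * q ^ 2 / 2)) * snd h)))) (at (x, y))"
    using Phi_has_derivative[OF has_derivative_minus[OF d_plus_has_derivative[OF xy]]]
    unfolding fst_conv snd_conv std_normal_density_dp[OF xy]
    by (simp only: q_def X_def d_def E_def mult_ac)
  have 3: "((\<lambda>p. fst p * Phi (- d_plus K r T (fst p) (snd p))) has_derivative
     (\<lambda>h. E * - (X * q * fst h + (- (d * q ^ 2 / 2)) * snd h) + fst h * Phi (- d_plus K r T x y))) (at (x, y))"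
    using has_derivative_mult[OF has_derivative_fst[OF has_derivative_ident] 2]
    unfolding fst_conv snd_conv xX .
  have m: "c0 / 2 * bs_monom 0 0 1 x y = E * q / 2"
    by (simp add: bs_monom_def E_def d_def q_def)
  show ?thesis
    unfolding BS_put_def m
    by (rule has_derivative_eq_rhs, rule has_derivative_diff[OF 1 3]) (simp add: fun_eq_iff algebra_simps)
qed

lemma Phi_d_plus_has_derivative:
  assumes xy: "x > 0" "y > 0"
  shows "((\<lambda>p. - Phi (- d_plus K r T (fst p) (snd p))) has_derivative
    (\<lambda>h. (c0 * bs_monom 2 0 1 x y) * fst h + (- c0 / 2 * bs_monom 1 1 2 x y) * snd h)) (at (x, y))"
proof -
  define q where "q = 1 / sqrt y"
  define X where "X = 1 / x"
  define d where "d = dm x y"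
  define e where "e = exp (- d\<^sup>2 / 2)"
  show ?thesis
    by (rule has_derivative_eq_rhs, rule has_derivative_minus[OF Phi_has_derivative[OF has_derivative_minus[OF d_plus_has_derivative[OF xy]]]])
      (simp add: fun_eq_iff std_normal_density_dp[OF xy] bs_monom_def
         del: power_one_over flip: q_def X_def d_def e_def; simp add: algebra_simps power2_eq_square)
qed

text \<open>The price and its x-derivative contain \<open>Phi\<close> and are treated by hand. The
  first y-derivative and the derivatives of the x-derivative are single monomials up to a constant;
  they start the inductions below.\<close>

lemma BS_put_partials:
  shows total_diff_BS_put: "total_diff (BS_put K r T)"
    and total_diff_dx_BS_put: "total_diff (dx (BS_put K r T))"
    and bs_span_dy: "bs_span 0 (dy (BS_put K r T))"
    and bs_span_dx_dx: "bs_span 2 (dx (dx (BS_put K r T)))"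
    and bs_span_dy_dx: "bs_span 1 (dy (dx (BS_put K r T)))"
proof -
  note e1 = dx_dy_eqI[OF BS_put_has_derivative]
  show "total_diff (BS_put K r T)"
    unfolding total_diff_def
    by (rule has_partialsI, unfold e1) (rule BS_put_has_derivative)
  have span: "bs_span a f" if "i \<le> j" "\<And>x y. x > 0 \<Longrightarrow> y > 0 \<Longrightarrow> f x y = c * bs_monom a i j x y" for a c i j f
    by (rule bs_span.span_cong[OF bs_span.span_scale[OF bs_span.span_monom]]) (use that in auto)
  show "bs_span 0 (dy (BS_put K r T))"
    by (rule span[of 0 1 _ "c0 / 2"]) (use e1 in auto)
  have D: "((\<lambda>p. dx (BS_put K r T) (fst p) (snd p)) has_derivative
    (\<lambda>h. (c0 * bs_monom 2 0 1 x y) * fst h + (- c0 / 2 * bs_monom 1 1 2 x y) * snd h)) (at (x, y))"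
    if "x > 0" "y > 0" for x y
    by (rule has_derivative_cong_quadrant[OF Phi_d_plus_has_derivative]) (use that e1(1) in auto)
  note e2 = dx_dy_eqI[OF D]
  show "total_diff (dx (BS_put K r T))"
    unfolding total_diff_def
    by (rule has_partialsI, unfold e2) (rule D)
  show "bs_span 2 (dx (dx (BS_put K r T)))"
    by (rule span[of 0 1 _ c0 2, OF zero_le_one e2(1)])
  show "bs_span 1 (dy (dx (BS_put K r T)))"
    by (rule span[of 1 2 _ "- c0 / 2" 1, OF one_le_numeral e2(2)])
qed

lemma smooth_BS_put: "smooth_quadrant (BS_put K r T)"
  by (rule smooth_quadrantI[OF total_diff_BS_put
        smooth_quadrantI[OF total_diff_dx_BS_put bs_span_smooth[OF bs_span_dx_dx] bs_span_smooth[OF bs_span_dy_dx]]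
        bs_span_smooth[OF bs_span_dy]])

text \<open>The innermost derivative decides: a first \<open>dy\<close> lands in the span at index
  0, while pure x-derivatives enter it after two steps, at index 2.\<close>

lemma bs_span_mixed_partial:
  assumes "a + b \<ge> 2"
  shows "bs_span a (mixed_partial a b (BS_put K r T))"
proof (cases b)
  case 0
  have "bs_span (a + 2) (mixed_partial (a + 2) 0 (BS_put K r T))" for a
    using bs_span_dx_dx by (induction a) (auto simp: mixed_partial_def bs_span_partials numeral_2_eq_2)
  moreover have "a = (a - 2) + 2" using assms 0 by simp
  ultimately show ?thesis using 0 by metis
next
  case (Suc b')
  have "bs_span 0 ((dy ^^ Suc b') (BS_put K r T))"
    by (induction b') (auto intro: bs_span_dy bs_span_partials)
  then show ?thesis
    unfolding mixed_partial_def Suc by (induction a) (auto intro: bs_span_partials)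
qed

lemma remainder_kernel_bound:
  assumes ab: "a + b = N + 1" "N \<ge> 1" and pos: "x0 > 0" "\<delta> > 0"
  shows "\<exists>C\<ge>0. \<forall>u\<in>{0..<1}. \<forall>x y. x \<ge> (1 - u) * x0 \<longrightarrow> y \<ge> \<delta> \<longrightarrow>
    \<bar>(1 - u) ^ N * mixed_partial a b (BS_put K r T) x y\<bar> \<le> C"
proof -
  let ?D = "mixed_partial a b (BS_put K r T)"
  from bs_span_bound[OF bs_span_mixed_partial pos(2), of a b] ab obtain C where
    C: "C \<ge> 0" "\<And>x y. x > 0 \<Longrightarrow> y \<ge> \<delta> \<Longrightarrow> \<bar>?D x y\<bar> * x ^ a \<le> C * min 1 x" by auto
  have "\<bar>(1 - u) ^ N * ?D x y\<bar> \<le> C / x0 ^ (a - 1)"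
    if u: "u \<in> {0..<1}" and x: "x \<ge> (1 - u) * x0" and y: "y \<ge> \<delta>" for u x y
  proof -
    have "0 < (1 - u) * x0" using u pos by simp
    with x have x0: "x > 0" by linarith
    \<comment> \<open>The subtraction is truncated: for \<open>a = 0\<close> the constant bound
      applies, otherwise the bound by \<open>x\<close> cancels one power.\<close>
    have *: "\<bar>?D x y\<bar> * x ^ (a - 1) \<le> C"
    proof (cases a)
      case 0
      then show ?thesis using C(2)[OF x0 y] C(1) mult_left_mono[of "min 1 x" 1 C] by simp
    next
      case (Suc a')
      have "(\<bar>?D x y\<bar> * x ^ a') * x \<le> C * x"
        using C(2)[OF x0 y] C(1) mult_left_mono[of "min 1 x" x C] Suc by (simp add: mult_ac)
      then show ?thesis using x0 Suc by simp
    qed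
    \<comment> \<open>The exponent may be lowered because \<open>a \<le> N + 1\<close>. Then
      \<open>x \<ge> (1 - u) * x0\<close> trades \<open>1 - u\<close> for \<open>x / x0\<close>,
      which cancels the singularity at \<open>x = 0\<close>.\<close>
    have "(1 - u) ^ N \<le> (1 - u) ^ (a - 1)"
      using u ab by (intro power_decreasing) auto
    also have "\<dots> \<le> (x / x0) ^ (a - 1)"
      using x pos u by (intro power_mono) (auto simp: field_simps)
    finally have "\<bar>(1 - u) ^ N * ?D x y\<bar> \<le> (x / x0) ^ (a - 1) * \<bar>?D x y\<bar>"
      using u by (simp add: abs_mult mult_right_mono)
    also have "\<dots> \<le> C / x0 ^ (a - 1)"
      using * pos by (simp add: power_divide field_simps)
    finally show ?thesis .
  qed
  moreover have "C / x0 ^ (a - 1) \<ge> 0" using C pos by simp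
  ultimately show ?thesis by blast
qed

text \<open>The undiscounted Black-Scholes formula. In units of \<open>s = sqrt V\<close> the put is
  exercised exactly for \<open>z \<le> a = - d_minus\<close>. The tilt
  \<open>exp (s * z - V / 2)\<close> shifts the normal density by \<open>s\<close>, which moves the
  threshold of the stock term to \<open>a - s = - d_plus\<close>.\<close>

lemma put_payoff_normal_expectation:
  assumes x: "x > 0" and V: "V > 0"
  shows "(LINT z|lborel. normal_density 0 (sqrt V) z * max (K - x * exp (r * T - V / 2 + z)) 0)
    = exp (r * T) * BS_put K r T x V"
proof -
  define s where "s = sqrt V"
  have s: "s > 0" "s\<^sup>2 = V" using V by (auto simp: s_def)
  define a where "a = - dm x V"
  have dp: "- d_plus K r T x V = a - s"
    using dm_squared_shift(2)[OF x V] by (simp add: a_def s_def)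
  have nd: "normal_density 0 s (s * z) * s = std_normal_density z" for z
    using s(1) by (simp add: normal_density_def real_sqrt_mult power_mult_distrib field_simps)
  have as: "s * a = ln (K / x) - r * T + V / 2"
    using s K_pos x by (simp add: a_def d_minus_def s_def[symmetric] ln_div)
  have "(LINT z|lborel. normal_density 0 s z * max (K - x * exp (r * T - V / 2 + z)) 0)
     = (LINT z|lborel. s * (normal_density 0 s (s * z) * max (K - x * exp (r * T - V / 2 + s * z)) 0))"
    using lborel_integral_real_affine[of s "\<lambda>z. normal_density 0 s z * max (K - x * exp (r * T - V / 2 + z)) 0" 0] s
    by simp
  also have "\<dots> = (LINT z|lborel. std_normal_density z * max (K - x * exp (r * T - V / 2 + s * z)) 0)"
    by (simp add: mult_ac flip: nd)
  also have "\<dots> = (LINT z|lborel. K * (indicator {..a} z * std_normal_density z)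
      - x * exp (r * T) * (indicator {..a - s} (- s + z) * std_normal_density (- s + z)))"
  proof (rule Bochner_Integration.integral_cong[OF refl])
    fix z :: real
    have "K - x * exp (r * T - V / 2 + s * z) \<ge> 0 \<longleftrightarrow> exp (r * T - V / 2 + s * z) \<le> K / x"
      using x by (simp add: field_simps)
    also have "\<dots> \<longleftrightarrow> r * T - V / 2 + s * z \<le> ln (K / x)"
      using K_pos x by (subst ln_ge_iff) auto
    also have "\<dots> \<longleftrightarrow> s * z \<le> s * a" using as by (intro iffI) linarith+
    also have "\<dots> \<longleftrightarrow> z \<le> a" using s by simp
    finally have iff: "K - x * exp (r * T - V / 2 + s * z) \<ge> 0 \<longleftrightarrow> z \<le> a" .
    have "exp (- V / 2 + s * z) * std_normal_density z = std_normal_density (- s + z)"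
    proof -
      have "- V / 2 + s * z + - z\<^sup>2 / 2 = - (- s + z)\<^sup>2 / 2"
        unfolding s(2)[symmetric] by (simp add: power2_eq_square field_simps)
      then show ?thesis
        unfolding std_normal_density_def by (metis (no_types, lifting) exp_add mult.left_commute)
    qed
    then have n: "x * exp (r * T) * std_normal_density (- s + z) = x * exp (r * T - V / 2 + s * z) * std_normal_density z"
      using exp_add[of "r * T" "- V / 2 + s * z"] by (simp add: algebra_simps)
    show "std_normal_density z * max (K - x * exp (r * T - V / 2 + s * z)) 0 =
      K * (indicator {..a} z * std_normal_density z)
      - x * exp (r * T) * (indicator {..a - s} (- s + z) * std_normal_density (- s + z))"
    proof (cases "z \<le> a")
      case True
      then have i: "indicator {..a} z = (1 :: real)" "indicator {..a - s} (- s + z) = (1 :: real)"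
        by (auto simp: indicator_def)
      from True iff have "max (K - x * exp (r * T - V / 2 + s * z)) 0 = K - x * exp (r * T - V / 2 + s * z)"
        by (intro max_absorb1) blast
      then show ?thesis
        unfolding i mult_1 n by (simp only: right_diff_distrib mult_ac)
    next
      case False
      then have i: "indicator {..a} z = (0 :: real)" "indicator {..a - s} (- s + z) = (0 :: real)"
        by (auto simp: indicator_def)
      from False iff have "max (K - x * exp (r * T - V / 2 + s * z)) 0 = 0"
        by (intro max_absorb2) linarith
      then show ?thesis
        unfolding i by simp
    qed
  qed
  also have "\<dots> = K * Phi a - x * exp (r * T) * Phi (a - s)"
  proof -
    have *: "(LINT z|lborel. indicator {..a - s} (- s + z) * std_normal_density (- s + z)) = Phi (a - s)"
      unfolding Phi_eq_integral
      using lborel_integral_real_affine[of 1 "\<lambda>z. indicator {..a - s} z * std_normal_density z" "- s"] by simp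
    have "integrable lborel (\<lambda>z. indicator {..a - s} (- s + z) * std_normal_density (- s + z))"
      using lborel_integrable_real_affine[OF integrable_indicator_std_normal, of 1 "a - s" "- s"] by simp
    then show ?thesis
      using * by (subst Bochner_Integration.integral_diff) (auto simp: Phi_eq_integral[symmetric])
  qed
  also have "\<dots> = exp (r * T) * BS_put K r T x V"
  proof -
    have "exp (r * T) * exp (- r * T) = 1" by (simp flip: exp_add)
    then show ?thesis unfolding BS_put_def dp a_def[symmetric] by algebra
  qed
  finally show ?thesis by (simp add: s_def)
qed

end

subsection \<open>Exponential moments of a subordinator\<close>

text \<open>Cauchy's equation under monotonicity: comparing \<open>n * t\<close> with the
  neighbouring integers bounds n times the distance of \<open>L t\<close> from
  \<open>t * L 1\<close> by \<open>L 1\<close>, for every n.\<close>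

lemma additive_mono_linear:
  fixes L :: "real \<Rightarrow> real"
  assumes add: "\<And>s t. s \<ge> 0 \<Longrightarrow> t \<ge> 0 \<Longrightarrow> L (s + t) = L s + L t"
    and mono: "mono_on {0..} L" and t: "t \<ge> 0"
  shows "L t = t * L 1"
proof -
  have mult: "L (real n * s) = real n * L s" if "s \<ge> 0" for n s
  proof (induction n)
    case 0
    then show ?case using add[of 0 0] by simp
  next
    case (Suc n)
    then show ?case using add[of "real n * s" s] that by (simp add: algebra_simps)
  qed
  have L1: "L 1 \<ge> 0" using mono_onD[OF mono, of 0 1] mult[of 1 0] by simp
  have "real n * \<bar>L t - t * L 1\<bar> \<le> L 1" for n
  proof -
    define k where "k = nat \<lfloor>real n * t\<rfloor>"
    have "real k = of_int \<lfloor>real n * t\<rfloor>" using t by (simp add: k_def)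
    then have k: "real k \<le> real n * t" "real n * t \<le> real (Suc k)"
      using of_int_floor_le[of "real n * t"] real_of_int_floor_add_one_ge[of "real n * t"]
      unfolding of_nat_Suc by linarith+
    have "L (real k * 1) \<le> L (real n * t)" "L (real n * t) \<le> L (real (Suc k) * 1)"
      using k t by (intro mono_onD[OF mono]; simp)+
    then have 1: "real k * L 1 \<le> real n * L t" "real n * L t \<le> real (Suc k) * L 1"
      using t by (simp_all only: mult zero_le_one)
    have 2: "real k * L 1 \<le> real n * t * L 1" "real n * t * L 1 \<le> real (Suc k) * L 1"
      using k L1 by (intro mult_right_mono; simp)+
    have "real (Suc k) * L 1 = real k * L 1 + L 1" by (simp add: algebra_simps)
    with 1 2 have "\<bar>real n * L t - real n * t * L 1\<bar> \<le> L 1" by linarith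
    also have "real n * L t - real n * t * L 1 = real n * (L t - t * L 1)" by (simp add: algebra_simps)
    finally show ?thesis by (simp add: abs_mult)
  qed
  then show ?thesis
    using reals_Archimedean3[of "\<bar>L t - t * L 1\<bar>"] by (metis abs_le_zero_iff linorder_not_less eq_iff_diff_eq_0)
qed

lemma subordinatorD:
  assumes "subordinator M Z" "\<omega> \<in> space M"
  shows subordinator_0: "Z 0 \<omega> = 0"
    and subordinator_mono: "0 \<le> s \<Longrightarrow> s \<le> t \<Longrightarrow> Z s \<omega> \<le> Z t \<omega>"
    and subordinator_right_cont: "0 \<le> t \<Longrightarrow> continuous (at_right t) (\<lambda>s. Z s \<omega>)"
    and subordinator_nonneg: "0 \<le> t \<Longrightarrow> 0 \<le> Z t \<omega>"
proof -
  show Z0: "Z 0 \<omega> = 0" and m: "0 \<le> s \<Longrightarrow> s \<le> t \<Longrightarrow> Z s \<omega> \<le> Z t \<omega>" for s t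
    using assms mono_onD[of "{0..}" "\<lambda>t. Z t \<omega>" s t] by (auto simp: subordinator_def)
  show "0 \<le> t \<Longrightarrow> continuous (at_right t) (\<lambda>s. Z s \<omega>)"
    using assms by (auto simp: subordinator_def)
  show "0 \<le> t \<Longrightarrow> 0 \<le> Z t \<omega>" using Z0 m[of 0 t] by simp
qed

lemma subordinator_measurable: "subordinator M Z \<Longrightarrow> Z t \<in> borel_measurable M"
  by (simp add: subordinator_def)

text \<open>Stated for nonnegative integrals so that multiplicativity is available before finiteness
  and can help to prove it.\<close>

lemma (in prob_space) subordinator_nn_mgf_add:
  assumes Z: "subordinator M Z" and st: "s \<ge> 0" "t \<ge> 0"
  shows "(\<integral>\<^sup>+\<omega>. ennreal (exp (\<rho> * Z (s + t) \<omega>)) \<partial>M)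
    = (\<integral>\<^sup>+\<omega>. ennreal (exp (\<rho> * Z s \<omega>)) \<partial>M) * (\<integral>\<^sup>+\<omega>. ennreal (exp (\<rho> * Z t \<omega>)) \<partial>M)"
proof -
  note [measurable] = subordinator_measurable[OF Z]
  define ts where "ts = [0, s, s + t]"
  define X where "X i \<omega> = ennreal (exp (\<rho> * (Z (ts ! Suc i) \<omega> - Z (ts ! i) \<omega>)))" for i \<omega>
  have "indep_increments M Z" using Z by (simp add: subordinator_def)
  moreover have "sorted ts" "\<forall>t\<in>set ts. 0 \<le> t" using st by (auto simp: ts_def)
  ultimately have "indep_vars (\<lambda>_. borel) (\<lambda>i \<omega>. Z (ts ! Suc i) \<omega> - Z (ts ! i) \<omega>) {..<length ts - 1}"
    unfolding indep_increments_def by blast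
  then have "indep_vars (\<lambda>_. borel) X {..<2}"
    unfolding X_def by (intro indep_vars_compose2[where Y="\<lambda>_ x. ennreal (exp (\<rho> * x))"])
      (auto simp: ts_def numeral_2_eq_2)
  then have *: "(\<integral>\<^sup>+\<omega>. (\<Prod>i<2. X i \<omega>) \<partial>M) = (\<Prod>i<2. \<integral>\<^sup>+\<omega>. X i \<omega> \<partial>M)"
    by (intro indep_vars_nn_integral) auto
  have "(\<integral>\<^sup>+\<omega>. (\<Prod>i<2. X i \<omega>) \<partial>M) = (\<integral>\<^sup>+\<omega>. ennreal (exp (\<rho> * Z (s + t) \<omega>)) \<partial>M)"
    by (intro nn_integral_cong)
      (simp add: X_def ts_def numeral_2_eq_2 subordinator_0[OF Z] algebra_simps flip: exp_add ennreal_mult)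
  moreover have "(\<integral>\<^sup>+\<omega>. X 0 \<omega> \<partial>M) = (\<integral>\<^sup>+\<omega>. ennreal (exp (\<rho> * Z s \<omega>)) \<partial>M)"
    by (intro nn_integral_cong) (simp add: X_def ts_def subordinator_0[OF Z])
  moreover have "(\<integral>\<^sup>+\<omega>. X 1 \<omega> \<partial>M) = (\<integral>\<^sup>+\<omega>. ennreal (exp (\<rho> * Z t \<omega>)) \<partial>M)"
  proof -
    have "(\<integral>\<^sup>+\<omega>. X 1 \<omega> \<partial>M) = (\<integral>\<^sup>+x. ennreal (exp (\<rho> * x)) \<partial>distr M borel (\<lambda>\<omega>. Z (s + t) \<omega> - Z s \<omega>))"
      by (subst nn_integral_distr) (auto simp: X_def[abs_def] ts_def)
    also have "distr M borel (\<lambda>\<omega>. Z (s + t) \<omega> - Z s \<omega>) = distr M borel (Z t)"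
      using Z st by (simp add: subordinator_def)
    also have "(\<integral>\<^sup>+x. ennreal (exp (\<rho> * x)) \<partial>distr M borel (Z t)) = (\<integral>\<^sup>+\<omega>. ennreal (exp (\<rho> * Z t \<omega>)) \<partial>M)"
      by (subst nn_integral_distr) auto
    finally show ?thesis .
  qed
  ultimately show ?thesis using * by (simp add: numeral_2_eq_2)
qed

text \<open>Some \<open>\<theta> > \<rho>\<close> has a finite moment at time 1, hence so has
  \<open>\<rho>\<close> as \<open>Z\<close> is nonnegative. Multiplicativity makes the logarithm of
  the moment additive in time, and monotonicity of the paths makes it monotone, hence
  linear.\<close>

lemma (in prob_space) subordinator_mgf:
  assumes Z: "subordinator M Z" and \<rho>: "ereal \<rho> < kappa_hat M Z" and t: "t \<ge> 0"
  shows "integrable M (\<lambda>\<omega>. exp (\<rho> * Z t \<omega>))"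
    and "expectation (\<lambda>\<omega>. exp (\<rho> * Z t \<omega>)) = exp (t * kappa M Z \<rho>)"
proof -
  note [measurable] = subordinator_measurable[OF Z]
  define \<psi> where "\<psi> t = (\<integral>\<^sup>+\<omega>. ennreal (exp (\<rho> * Z t \<omega>)) \<partial>M)" for t
  have add: "\<psi> (s + t) = \<psi> s * \<psi> t" if "s \<ge> 0" "t \<ge> 0" for s t
    unfolding \<psi>_def by (rule subordinator_nn_mgf_add[OF Z that])
  obtain \<theta> where \<theta>: "\<rho> < \<theta>" "(\<integral>\<^sup>+\<omega>. ennreal (exp (\<theta> * Z 1 \<omega>)) \<partial>M) < \<infinity>"
    using \<rho> unfolding kappa_hat_def less_Sup_iff by auto
  have 1: "\<psi> 1 < \<infinity>"
  proof -
    have "\<psi> 1 \<le> (\<integral>\<^sup>+\<omega>. ennreal (exp (\<theta> * Z 1 \<omega>)) \<partial>M)"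
      unfolding \<psi>_def using \<theta>(1)
      by (intro nn_integral_mono ennreal_leI) (auto intro!: mult_right_mono subordinator_nonneg[OF Z])
    then show ?thesis using \<theta>(2) by (rule le_less_trans)
  qed
  have 0: "\<psi> 0 = 1"
    unfolding \<psi>_def by (subst nn_integral_cong[where v="\<lambda>_. 1"]) (auto simp: subordinator_0[OF Z] emeasure_space_1)
  have n: "\<psi> (real n) < \<infinity>" for n
  proof (induction n)
    case (Suc n)
    then show ?case using add[of "real n" 1] 1 by (simp add: ennreal_mult_less_top add.commute)
  qed (simp add: 0)
  \<comment> \<open>For \<open>\<rho> \<ge> 0\<close> the moment grows with time and is compared
    with the next integer time; for \<open>\<rho> < 0\<close> the integrand is at most 1.\<close>
  have fin: "\<psi> t < \<infinity>" if "t \<ge> 0" for t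
  proof (cases "\<rho> \<ge> 0")
    case True
    have "\<psi> t \<le> \<psi> (real (nat \<lceil>t\<rceil>))"
      unfolding \<psi>_def using True that
      by (intro nn_integral_mono ennreal_leI) (auto intro!: mult_left_mono subordinator_mono[OF Z] simp: of_nat_ceiling)
    then show ?thesis using n by (rule le_less_trans)
  next
    case False
    have "\<psi> t \<le> (\<integral>\<^sup>+\<omega>. 1 \<partial>M)"
      unfolding \<psi>_def using False that
      by (intro nn_integral_mono) (auto intro!: mult_nonpos_nonneg subordinator_nonneg[OF Z])
    then show ?thesis by (auto simp: emeasure_space_1 intro: le_less_trans)
  qed
  have int: "integrable M (\<lambda>\<omega>. exp (\<rho> * Z t \<omega>))" if "t \<ge> 0" for t
    using fin[OF that] by (intro integrableI_nonneg) (auto simp: \<psi>_def)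
  then show "integrable M (\<lambda>\<omega>. exp (\<rho> * Z t \<omega>))" using t by simp
  define \<phi> where "\<phi> t = expectation (\<lambda>\<omega>. exp (\<rho> * Z t \<omega>))" for t
  have \<psi>: "\<psi> t = ennreal (\<phi> t)" if "t \<ge> 0" for t
    unfolding \<psi>_def \<phi>_def by (rule nn_integral_eq_integral[OF int[OF that]]) simp
  have \<phi>0: "\<phi> t \<ge> 0" for t
    unfolding \<phi>_def by (intro integral_nonneg_AE) auto
  have pos: "\<phi> t > 0" if "t \<ge> 0" for t
  proof -
    have "\<phi> t \<noteq> 0"
      unfolding \<phi>_def by (subst integral_nonneg_eq_0_iff_AE) (auto simp: int that emeasure_space_1 AE_False)
    with \<phi>0[of t] show ?thesis by simp
  qed
  have mult: "\<phi> (s + t) = \<phi> s * \<phi> t" if "s \<ge> 0" "t \<ge> 0" for s t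
    using add[OF that] \<phi>0 that by (simp add: \<psi> flip: ennreal_mult)
  define L where "L t = ln (\<phi> t)" for t
  have L: "L (s + t) = L s + L t" if "s \<ge> 0" "t \<ge> 0" for s t
    using mult[OF that] pos[OF that(1)] pos[OF that(2)] by (simp add: L_def ln_mult_pos)
  have "L t = t * L 1"
  proof (cases "\<rho> \<ge> 0")
    case True
    have "mono_on {0..} L"
    proof (rule mono_onI)
      fix s t :: real assume st: "s \<in> {0..}" "t \<in> {0..}" "s \<le> t"
      have "\<phi> s \<le> \<phi> t"
        unfolding \<phi>_def using st True int
        by (intro integral_mono) (auto intro!: mult_left_mono subordinator_mono[OF Z])
      then show "L s \<le> L t" unfolding L_def using pos st by simp
    qed
    then show ?thesis by (intro additive_mono_linear L t)
  next
    case False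
    have "mono_on {0..} (\<lambda>t. - L t)"
    proof (rule mono_onI)
      fix s t :: real assume st: "s \<in> {0..}" "t \<in> {0..}" "s \<le> t"
      have "\<phi> t \<le> \<phi> s"
        unfolding \<phi>_def using st False int
        by (intro integral_mono) (auto intro!: mult_left_mono_neg subordinator_mono[OF Z])
      then show "- L s \<le> - L t" unfolding L_def using pos st by simp
    qed
    then have "- L t = t * - L 1" by (intro additive_mono_linear[where L="\<lambda>t. - L t"] t) (auto simp: L)
    then show ?thesis by simp
  qed
  moreover have "L 1 = kappa M Z \<rho>" by (simp add: L_def \<phi>_def kappa_def)
  ultimately have "\<phi> t = exp (t * kappa M Z \<rho>)" using pos[OF t] by (simp add: L_def) (metis exp_ln)
  then show "expectation (\<lambda>\<omega>. exp (\<rho> * Z t \<omega>)) = exp (t * kappa M Z \<rho>)" by (simp add: \<phi>_def)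
qed

subsection \<open>Convergence of left-point Riemann--Stieltjes sums\<close>

text \<open>The sum is the integral of a step function converging to \<open>f\<close> at every
  continuity point, and dominated convergence applies. This form covers both uses: the continuous
  \<open>exp (lam * s)\<close> against the measure of a path with jumps, and the variance, which has
  jumps, against Lebesgue measure.\<close>

lemma left_riemann_sums_tendsto:
  fixes f :: "real \<Rightarrow> real" and \<mu> :: "real measure"
  assumes sets_\<mu> [measurable_cong]: "sets \<mu> = sets borel" and t: "t \<ge> 0"
    and fin: "emeasure \<mu> {0<..t} < \<infinity>"
    and f [measurable]: "f \<in> borel_measurable borel"
    and bound: "\<And>s. s \<in> {0..t} \<Longrightarrow> \<bar>f s\<bar> \<le> C"
    and cont: "AE s in \<mu>. isCont f s"
  shows "(\<lambda>n. \<Sum>j<n. f (real j * t / real n) * measure \<mu> {real j * t / real n<..real (Suc j) * t / real n})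
     \<longlonglongrightarrow> (LINT s:{0<..t}|\<mu>. f s)"
proof -
  define p where "p n j = real j * t / real n" for n j :: nat
  define g where "g n s = (\<Sum>j<n. f (p n j) * indicator {p n j<..p n (Suc j)} s)" for n s
  have p_mono: "p n i \<le> p n j" if "i \<le> j" for n i j
    using that t by (auto simp: p_def intro!: divide_right_mono mult_right_mono)
  have pn: "p n n = t" if "n > 0" for n using that by (simp add: p_def)
  have p0: "p n 0 = 0" for n by (simp add: p_def)
  have sub: "{p n j<..p n (Suc j)} \<subseteq> {0<..t}" if "j < n" for n j
    using p_mono[of 0 j n] p_mono[of "Suc j" n n] pn[of n] p0 that by auto
  have cell: "\<exists>j<n. p n j < s \<and> s \<le> p n (Suc j) \<and> g n s = f (p n j)" if s: "s \<in> {0<..t}" and n: "n > 0" for n s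
  proof -
    \<comment> \<open>The first cell whose right endpoint reaches \<open>s\<close>; by minimality
      its left endpoint lies strictly below \<open>s\<close>.\<close>
    define j where "j = (LEAST i. s \<le> p n (Suc i))"
    have ex: "s \<le> p n (Suc (n - 1))" using pn[OF n] s n by simp
    have j1: "s \<le> p n (Suc j)" unfolding j_def by (rule LeastI[of _ "n - 1"]) (rule ex)
    have jn: "j < n" using Least_le[of "\<lambda>i. s \<le> p n (Suc i)" "n - 1", OF ex] n by (simp add: j_def)
    have j2: "p n j < s"
    proof (cases j)
      case 0
      then show ?thesis using s p0 by simp
    next
      case (Suc i)
      then show ?thesis using not_less_Least[of i "\<lambda>i. s \<le> p n (Suc i)"] by (simp add: j_def not_le)
    qed
    have "indicator {p n i<..p n (Suc i)} s = (if i = j then 1 else 0 :: real)" for i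
      using j1 j2 p_mono[of "Suc i" j n] p_mono[of "Suc j" i n] by (cases i j rule: linorder_cases) (auto simp: indicator_def)
    then have "g n s = f (p n j)"
      using jn by (simp add: g_def if_distrib[of "\<lambda>x. _ * x"] cong: if_cong)
    with j1 j2 jn show ?thesis by blast
  qed
  have g_zero: "g n s = 0" if "s \<notin> {0<..t} \<or> n = 0" for n s
    unfolding g_def
  proof (rule sum.neutral, intro ballI)
    fix j assume "j \<in> {..<n}"
    with sub[of j n] that have "s \<notin> {p n j<..p n (Suc j)}" by auto
    then show "f (p n j) * indicator {p n j<..p n (Suc j)} s = 0" by simp
  qed
  have fin': "emeasure \<mu> {p n j<..p n (Suc j)} < \<infinity>" if "j < n" for n j
    using emeasure_mono[OF sub[OF that]] fin by (metis sets_\<mu> greaterThanAtMost_borel le_less_trans)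
  have g_meas [measurable]: "g n \<in> borel_measurable \<mu>" for n
    unfolding g_def by measurable
  have int_g: "(LINT s|\<mu>. g n s) = (\<Sum>j<n. f (p n j) * measure \<mu> {p n j<..p n (Suc j)})" for n
    unfolding g_def using fin' by (subst Bochner_Integration.integral_sum) auto
  have C: "C \<ge> 0" using bound[of 0] t by auto
  have "(\<lambda>n. LINT s|\<mu>. g n s) \<longlonglongrightarrow> (LINT s|\<mu>. indicator {0<..t} s * f s)"
  proof (rule integral_dominated_convergence)
    show "integrable \<mu> (\<lambda>s. C * indicator {0<..t} s)" using fin by auto
    show "AE s in \<mu>. norm (g n s) \<le> C * indicator {0<..t} s" for n
    proof (rule AE_I2)
      fix s
      show "norm (g n s) \<le> C * indicator {0<..t} s"
      proof (cases "s \<in> {0<..t} \<and> n > 0")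
        case True
        then obtain j where j: "j < n" "p n j < s" "g n s = f (p n j)" using cell[of s n] by blast
        have "p n j \<in> {0..t}" using p_mono[of 0 j n] p0 j(2) True by auto
        then show ?thesis using bound j(3) True by simp
      next
        case False
        then show ?thesis using C g_zero by auto
      qed
    qed
    show "AE s in \<mu>. (\<lambda>n. g n s) \<longlonglongrightarrow> indicator {0<..t} s * f s"
      using cont
    proof eventually_elim
      case (elim s)
      show ?case
      proof (cases "s \<in> {0<..t}")
        case True
        define J where "J n = (SOME j. j < n \<and> p n j < s \<and> s \<le> p n (Suc j) \<and> g n s = f (p n j))" for n
        have J: "J n < n \<and> p n (J n) < s \<and> s \<le> p n (Suc (J n)) \<and> g n s = f (p n (J n))" if "n > 0" for n
          unfolding J_def using someI_ex[OF cell[OF True that]] by blast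
        \<comment> \<open>The left endpoint of the cell of \<open>s\<close> is at most one mesh
          width away.\<close>
        have lower: "s - t / real n \<le> p n (J n)" if "n > 0" for n
          using J[OF that] that by (simp add: p_def add_divide_distrib distrib_right)
        have "(\<lambda>n. p n (J n)) \<longlonglongrightarrow> s"
        proof (rule tendsto_sandwich)
          show "\<forall>\<^sub>F n in sequentially. s - t / real n \<le> p n (J n)"
            using eventually_gt_at_top[of 0] by eventually_elim (rule lower)
          show "\<forall>\<^sub>F n in sequentially. p n (J n) \<le> s"
            using eventually_gt_at_top[of 0] by eventually_elim (use J in \<open>auto intro: less_imp_le\<close>)
          show "(\<lambda>n. s - t / real n) \<longlonglongrightarrow> s"
            by (rule tendsto_eq_intros lim_const_over_n refl)+ simp
        qed simp
        then have "(\<lambda>n. f (p n (J n))) \<longlonglongrightarrow> f s"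
          by (rule isCont_tendsto_compose[OF elim])
        then have "(\<lambda>n. g n s) \<longlonglongrightarrow> f s"
          by (rule Lim_transform_eventually) (use eventually_gt_at_top[of 0] in eventually_elim, use J in auto)
        then show ?thesis using True by simp
      next
        case False
        then show ?thesis using g_zero by simp
      qed
    qed
  qed measurable
  then show ?thesis
    unfolding int_g set_lebesgue_integral_def p_def by simp
qed

subsection \<open>The variance process along a path\<close>

locale bns_path =
  fixes M :: "'a measure" and Z :: "real \<Rightarrow> 'a \<Rightarrow> real" and lam s0sq :: real and \<omega> :: 'a
  assumes subord: "subordinator M Z" and \<omega>: "\<omega> \<in> space M"
    and lam: "lam > 0" and s0sq: "s0sq > 0"
begin

text \<open>Constant continuation to the left gives a monotone right-continuous function on the
  whole line. Its measure has no atom at 0, so integrals over \<open>{0..t}\<close> and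
  \<open>{0<..t}\<close> agree.\<close>

definition F :: "real \<Rightarrow> real" where "F s = Z (lam * max s 0) \<omega>"

definition m :: "real \<Rightarrow> real" where "m t = (LINT s:{0..t}|interval_measure F. exp (lam * s))"

lemma sigma2_eq: "sigma2 lam s0sq Z t \<omega> = exp (- lam * t) * (s0sq + m t)"
  by (simp add: sigma2_def m_def F_def[abs_def])

lemma F_mono: "x \<le> y \<Longrightarrow> F x \<le> F y"
  unfolding F_def using lam by (intro subordinator_mono[OF subord \<omega>]) auto

lemma F_right_cont: "continuous (at_right a) F"
proof (cases "a \<ge> 0")
  case True
  have "filterlim (\<lambda>s. lam * s) (at_right (lam * a)) (at_right a)"
  proof (rule tendsto_imp_filterlim_at_right)
    show "((\<lambda>s. lam * s) \<longlongrightarrow> lam * a) (at_right a)" by (intro tendsto_intros)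
    show "\<forall>\<^sub>F s in at_right a. lam * a < lam * s"
      using eventually_at_right_less[of a] by eventually_elim (use lam in auto)
  qed
  moreover have "((\<lambda>s. Z s \<omega>) \<longlongrightarrow> Z (lam * a) \<omega>) (at_right (lam * a))"
    using subordinator_right_cont[OF subord \<omega>, of "lam * a"] lam True by (simp add: continuous_within)
  ultimately have "((\<lambda>s. Z (lam * s) \<omega>) \<longlongrightarrow> Z (lam * a) \<omega>) (at_right a)"
    by (rule filterlim_compose[rotated])
  moreover have "\<forall>\<^sub>F s in at_right a. Z (lam * s) \<omega> = F s"
    using eventually_at_right_less[of a] by eventually_elim (use True in \<open>simp add: F_def\<close>)
  ultimately have "(F \<longlongrightarrow> Z (lam * a) \<omega>) (at_right a)"
    by (rule Lim_transform_eventually)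
  then show ?thesis using True by (simp add: continuous_within F_def)
next
  case False
  have "\<forall>\<^sub>F s in at_right a. F a = F s"
    using eventually_at_right_real[of a 0] False by (auto simp: F_def elim!: eventually_mono)
  then have "(F \<longlongrightarrow> F a) (at_right a)"
    by (rule Lim_transform_eventually[OF tendsto_const])
  then show ?thesis by (simp add: continuous_within)
qed

lemma emeasure_Ioc: "a \<le> b \<Longrightarrow> emeasure (interval_measure F) {a<..b} = ennreal (F b - F a)"
  by (rule emeasure_interval_measure_Ioc) (auto intro: F_mono F_right_cont)

lemma measure_Ioc: "a \<le> b \<Longrightarrow> measure (interval_measure F) {a<..b} = F b - F a"
  using F_mono[of a b] by (simp add: measure_def emeasure_Ioc)

lemma finite_Icc: "emeasure (interval_measure F) {0..t} < \<infinity>"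
proof (cases "t \<ge> 0")
  case True
  have "emeasure (interval_measure F) {0..t} \<le> emeasure (interval_measure F) {-1<..t}"
    by (intro emeasure_mono) auto
  also have "\<dots> < \<infinity>" using emeasure_Ioc[of "-1" t] True by simp
  finally show ?thesis .
qed auto

lemma null_0: "{0} \<in> null_sets (interval_measure F)"
proof
  have "emeasure (interval_measure F) {0} \<le> emeasure (interval_measure F) {-1<..0}"
    by (intro emeasure_mono) auto
  also have "\<dots> = 0" using emeasure_Ioc[of "-1" 0] by (simp add: F_def)
  finally show "emeasure (interval_measure F) {0} = 0" by simp
qed simp

lemma integrable_exp: "set_integrable (interval_measure F) {0..t} (\<lambda>s. exp (lam * s))"
  unfolding set_integrable_def
proof (rule Bochner_Integration.integrable_bound)
  show "integrable (interval_measure F) (\<lambda>s. exp (lam * t) * indicator {0..t} s)"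
    using finite_Icc by (intro integrable_mult_right integrable_real_indicator) auto
  show "AE s in interval_measure F. norm (indicator {0..t} s *\<^sub>R exp (lam * s)) \<le> norm (exp (lam * t) * indicator {0..t} s :: real)"
    using lam by (intro AE_I2) (auto simp: indicator_def)
qed auto

text \<open>Monotonicity in time yields the measurability of the variance path, its bounds, and the
  countability of its discontinuities.\<close>

lemma m_mono: "mono m"
proof (rule monoI)
  fix s t :: real assume "s \<le> t"
  then show "m s \<le> m t"
    unfolding m_def set_lebesgue_integral_def
    using integrable_exp[unfolded set_integrable_def]
    by (intro integral_mono) (auto simp: indicator_def)
qed

lemma m_nonneg: "m t \<ge> 0"
  unfolding m_def set_lebesgue_integral_def by (intro integral_nonneg_AE AE_I2) auto

lemma m_tendsto:
  assumes t: "t \<ge> 0"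
  shows "(\<lambda>n. \<Sum>j<n. exp (lam * (real j * t / real n)) *
      (Z (lam * (real (Suc j) * t / real n)) \<omega> - Z (lam * (real j * t / real n)) \<omega>)) \<longlonglongrightarrow> m t"
proof -
  have "(\<lambda>n. \<Sum>j<n. exp (lam * (real j * t / real n)) *
      measure (interval_measure F) {real j * t / real n<..real (Suc j) * t / real n})
      \<longlonglongrightarrow> (LINT s:{0<..t}|interval_measure F. exp (lam * s))"
  proof (rule left_riemann_sums_tendsto[where C="exp (lam * t)"])
    show "emeasure (interval_measure F) {0<..t} < \<infinity>" using emeasure_Ioc[of 0 t] t by simp
  qed (use lam t in \<open>auto intro!: continuous_intros\<close>)
  also have "(LINT s:{0<..t}|interval_measure F. exp (lam * s)) = m t"
    unfolding m_def set_lebesgue_integral_def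
    by (intro integral_cong_AE AE_I'[OF null_0]) (auto simp: indicator_def)
  also have "(\<lambda>n. \<Sum>j<n. exp (lam * (real j * t / real n)) *
      measure (interval_measure F) {real j * t / real n<..real (Suc j) * t / real n})
     = (\<lambda>n. \<Sum>j<n. exp (lam * (real j * t / real n)) *
      (Z (lam * (real (Suc j) * t / real n)) \<omega> - Z (lam * (real j * t / real n)) \<omega>))"
    using t by (intro ext sum.cong refl) (subst measure_Ioc; simp add: F_def divide_right_mono mult_right_mono)
  finally show ?thesis .
qed

lemma sigma2_bounds:
  assumes "0 \<le> t" "t \<le> T"
  shows "exp (- lam * T) * s0sq \<le> sigma2 lam s0sq Z t \<omega>" "sigma2 lam s0sq Z t \<omega> \<le> s0sq + m T"
proof -
  have "exp (- lam * T) * s0sq \<le> exp (- lam * t) * (s0sq + m t)"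
    using assms lam s0sq m_nonneg[of t] by (intro mult_mono) auto
  then show "exp (- lam * T) * s0sq \<le> sigma2 lam s0sq Z t \<omega>" by (simp add: sigma2_eq)
  have "exp (- lam * t) * (s0sq + m t) \<le> 1 * (s0sq + m T)"
    using assms lam s0sq m_nonneg[of t] monoD[OF m_mono assms(2)] by (intro mult_mono) auto
  then show "sigma2 lam s0sq Z t \<omega> \<le> s0sq + m T" by (simp add: sigma2_eq)
qed

lemma sigma2_pos: "0 \<le> t \<Longrightarrow> sigma2 lam s0sq Z t \<omega> > 0"
  using less_le_trans[OF _ sigma2_bounds(1)[of t t]] s0sq by simp

lemma sigma2_borel_measurable: "(\<lambda>t. sigma2 lam s0sq Z t \<omega>) \<in> borel_measurable borel"
  unfolding sigma2_eq using borel_measurable_mono[OF m_mono] by measurable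

text \<open>Jumps only add variance, so the decayed initial variance is a lower bound throughout.
  This deterministic constant is the \<open>\<delta>\<close> that keeps the second argument of
  \<open>BS_put\<close> away from 0.\<close>

lemma intvar_lower_bound:
  assumes T: "T > 0"
  shows "exp (- lam * T) * s0sq * T \<le> intvar lam s0sq Z T \<omega>"
proof -
  have "exp (- lam * T) * s0sq * T = (LINT s|lborel. indicator {0..T} s * (exp (- lam * T) * s0sq))"
    using T by simp
  also have "\<dots> \<le> (LINT s|lborel. indicator {0..T} s * sigma2 lam s0sq Z s \<omega>)"
  proof (rule integral_mono)
    show "integrable lborel (\<lambda>s. indicator {0..T} s * sigma2 lam s0sq Z s \<omega>)"
    proof (rule Bochner_Integration.integrable_bound)
      show "integrable lborel (\<lambda>s. indicator {0..T} s * (s0sq + m T))"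
        using T by (intro integrable_mult_left integrable_real_indicator) auto
      show "(\<lambda>s. indicator {0..T} s * sigma2 lam s0sq Z s \<omega>) \<in> borel_measurable lborel"
        using sigma2_borel_measurable by measurable
      show "AE s in lborel. norm (indicator {0..T} s * sigma2 lam s0sq Z s \<omega>) \<le> norm (indicator {0..T} s * (s0sq + m T))"
      proof (rule AE_I2)
        fix s
        have "\<bar>sigma2 lam s0sq Z s \<omega>\<bar> \<le> \<bar>s0sq + m T\<bar>" if "s \<in> {0..T}"
          using sigma2_bounds(2)[of s T] sigma2_pos[of s] that by auto
        then show "norm (indicator {0..T} s * sigma2 lam s0sq Z s \<omega>) \<le> norm (indicator {0..T} s * (s0sq + m T))"
          by (auto simp: indicator_def)
      qed
    qed
    show "integrable lborel (\<lambda>s. indicator {0..T} s * (exp (- lam * T) * s0sq))"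
      using T by (intro integrable_mult_left integrable_real_indicator) auto
  qed (use sigma2_bounds(1)[of _ T] in \<open>auto simp: indicator_def\<close>)
  finally show ?thesis by (simp add: intvar_def set_lebesgue_integral_def)
qed

text \<open>The discontinuities of the variance are those of the monotone \<open>m\<close>, a
  countable and hence Lebesgue null set.\<close>

lemma intvar_riemann:
  assumes T: "T > 0"
  shows "(\<lambda>n. \<Sum>i<2 ^ n. sigma2 lam s0sq Z (real i * T / 2 ^ n) \<omega> * (T / 2 ^ n)) \<longlonglongrightarrow> intvar lam s0sq Z T \<omega>"
proof -
  have "(\<lambda>n. \<Sum>i<n. sigma2 lam s0sq Z (real i * T / real n) \<omega> *
      measure lborel {real i * T / real n<..real (Suc i) * T / real n})
     \<longlonglongrightarrow> (LINT s:{0<..T}|lborel. sigma2 lam s0sq Z s \<omega>)"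
  proof (rule left_riemann_sums_tendsto[where C="s0sq + m T"])
    show "\<bar>sigma2 lam s0sq Z s \<omega>\<bar> \<le> s0sq + m T" if "s \<in> {0..T}" for s
      using sigma2_bounds(2)[of s T] sigma2_pos[of s] that by auto
    have "AE s in lborel. s \<notin> {s. \<not> isCont m s}"
      by (intro AE_not_in countable_imp_null_set_lborel mono_ctble_discont m_mono)
    then show "AE s in lborel. isCont (\<lambda>s. sigma2 lam s0sq Z s \<omega>) s"
      unfolding sigma2_eq by eventually_elim (auto intro!: continuous_intros)
  qed (use T sigma2_borel_measurable in auto)
  also have "(LINT s:{0<..T}|lborel. sigma2 lam s0sq Z s \<omega>) = intvar lam s0sq Z T \<omega>"
    unfolding intvar_def set_lebesgue_integral_def
    using sigma2_borel_measurable
    by (intro integral_cong_AE AE_I'[of "{0}"]) (auto simp: indicator_def)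
  also have "(\<lambda>n. \<Sum>i<n. sigma2 lam s0sq Z (real i * T / real n) \<omega> *
      measure lborel {real i * T / real n<..real (Suc i) * T / real n})
    = (\<lambda>n. \<Sum>i<n. sigma2 lam s0sq Z (real i * T / real n) \<omega> * (T / real n))"
    using T by (intro ext sum.cong refl) (subst measure_lborel_Ioc; simp add: field_simps)
  finally have "(\<lambda>n. \<Sum>i<n. sigma2 lam s0sq Z (real i * T / real n) \<omega> * (T / real n))
    \<longlonglongrightarrow> intvar lam s0sq Z T \<omega>" .
  from LIMSEQ_subseq_LIMSEQ[OF this, of "\<lambda>n. 2 ^ n"] show ?thesis
    by (simp add: o_def strict_mono_def)
qed

end

text \<open>The variance as a functional of the path of the subordinator, to make its measurability with
  respect to that path explicit.\<close>
definition path_variance :: "real \<Rightarrow> real \<Rightarrow> real \<Rightarrow> (real \<Rightarrow> real) \<Rightarrow> real" where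
  "path_variance lam s0sq t z = exp (- lam * t) * (s0sq + max 0 (lim (\<lambda>n. \<Sum>j<n.
     exp (lam * (real j * t / real n)) * (z (lam * (real (Suc j) * t / real n)) - z (lam * (real j * t / real n))))))"

text \<open>A set in the product sigma-algebra depends on countably many coordinates only. The
  Riemann sums use countably many times, which is why they replace the Stieltjes integral
  here.\<close>

lemma path_variance_measurable:
  assumes "lam > 0" "t \<ge> 0"
  shows "path_variance lam s0sq t \<in> borel_measurable (Pi\<^sub>M {0..} (\<lambda>_. borel))"
proof -
  have 1: "(\<lambda>z. z (lam * (real k * t / real n))) \<in> borel_measurable (Pi\<^sub>M {0..} (\<lambda>_. borel))" for k n
    using assms by (intro measurable_component_singleton) auto
  have "(\<lambda>z. lim (\<lambda>n. \<Sum>j<n. exp (lam * (real j * t / real n)) *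
      (z (lam * (real (Suc j) * t / real n)) - z (lam * (real j * t / real n)))))
    \<in> borel_measurable (Pi\<^sub>M {0..} (\<lambda>_. borel))"
    by (intro borel_measurable_lim_metric borel_measurable_sum borel_measurable_times borel_measurable_diff
        borel_measurable_const 1)
  then show ?thesis
    unfolding path_variance_def[abs_def]
    by (intro borel_measurable_times borel_measurable_add borel_measurable_max borel_measurable_const)
qed

text \<open>Thanks to the \<open>max 0\<close> in the definition this covers every function
  \<open>z\<close>, even if the limit fails to exist; Fubini will freeze arbitrary
  \<open>z\<close>.\<close>

lemma path_variance_pos: "s0sq > 0 \<Longrightarrow> path_variance lam s0sq t z > 0"
  by (simp add: path_variance_def add_pos_nonneg)

lemma (in bns_path) path_variance_eq:
  assumes "t \<ge> 0"
  shows "path_variance lam s0sq t (\<lambda>t\<in>{0..}. Z t \<omega>) = sigma2 lam s0sq Z t \<omega>"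
proof -
  have "(\<lambda>n. \<Sum>j<n. exp (lam * (real j * t / real n)) * ((\<lambda>t\<in>{0..}. Z t \<omega>) (lam * (real (Suc j) * t / real n))
      - (\<lambda>t\<in>{0..}. Z t \<omega>) (lam * (real j * t / real n)))) \<longlonglongrightarrow> m t"
    using m_tendsto[OF assms] lam assms by simp
  then show ?thesis
    unfolding path_variance_def sigma2_eq by (subst limI, assumption) (use m_nonneg[of t] in simp)
qed

subsection \<open>Conditioning on the variance path\<close>

lemma Phi_borel_measurable [measurable]: "Phi \<in> borel_measurable borel"
  by (intro borel_measurable_continuous_onI continuous_at_imp_continuous_on ballI
      DERIV_isCont[OF Phi_has_real_derivative])

lemma BS_put_borel_measurable [measurable (raw)]:
  assumes [measurable]: "f \<in> borel_measurable N" "g \<in> borel_measurable N"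
  shows "(\<lambda>x. BS_put K r T (f x) (g x)) \<in> borel_measurable N"
  unfolding BS_put_def d_plus_def d_minus_def by measurable

text \<open>The distance truncated at 1 is integrable without any moment assumption and tends to 0
  in L1, which provides the subsequence.\<close>

lemma (in prob_space) conv_in_prob_AE_subseq:
  assumes [measurable]: "\<And>n. X n \<in> borel_measurable M" "Y \<in> borel_measurable M"
    and conv: "conv_in_prob M X Y"
  shows "\<exists>r :: nat \<Rightarrow> nat. strict_mono r \<and> (AE \<omega> in M. (\<lambda>n. X (r n) \<omega>) \<longlonglongrightarrow> Y \<omega>)"
proof -
  define D where "D n \<omega> = min 1 \<bar>X n \<omega> - Y \<omega>\<bar>" for n \<omega>
  have [measurable]: "D n \<in> borel_measurable M" for n unfolding D_def by measurable
  have D01: "0 \<le> D n \<omega>" "D n \<omega> \<le> 1" for n \<omega> by (auto simp: D_def)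
  have int: "integrable M (D n)" for n
    by (rule integrable_const_bound[where B=1]) (use D01 in auto)
  have "(\<lambda>n. expectation (D n)) \<longlonglongrightarrow> 0"
  proof (rule order_tendstoI)
    fix \<epsilon> :: real assume \<epsilon>: "0 < \<epsilon>"
    have "(\<lambda>n. measure M {\<omega>\<in>space M. \<epsilon> / 2 < \<bar>X n \<omega> - Y \<omega>\<bar>}) \<longlonglongrightarrow> 0"
      using conv \<epsilon> unfolding conv_in_prob_def by (meson half_gt_zero)
    then have "\<forall>\<^sub>F n in sequentially. measure M {\<omega>\<in>space M. \<epsilon> / 2 < \<bar>X n \<omega> - Y \<omega>\<bar>} < \<epsilon> / 2"
      by (rule order_tendstoD) (use \<epsilon> in simp)
    then show "\<forall>\<^sub>F n in sequentially. expectation (D n) < \<epsilon>"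
    proof eventually_elim
      case (elim n)
      define A where "A = {\<omega>\<in>space M. \<epsilon> / 2 < \<bar>X n \<omega> - Y \<omega>\<bar>}"
      have [measurable]: "A \<in> sets M" unfolding A_def by measurable
      have "expectation (D n) \<le> expectation (\<lambda>\<omega>. \<epsilon> / 2 + indicator A \<omega>)"
      proof (rule integral_mono[OF int])
        show "integrable M (\<lambda>\<omega>. \<epsilon> / 2 + indicator A \<omega>)"
          by (intro Bochner_Integration.integrable_add integrable_real_indicator) (auto simp: emeasure_eq_measure)
        show "D n \<omega> \<le> \<epsilon> / 2 + indicator A \<omega>" if "\<omega> \<in> space M" for \<omega>
        proof (cases "\<omega> \<in> A")
          case True
          then show ?thesis using D01(2)[of n \<omega>] \<epsilon> by simp
        next
          case False
          have "D n \<omega> \<le> \<bar>X n \<omega> - Y \<omega>\<bar>" by (simp add: D_def)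
          with False that show ?thesis by (simp add: A_def)
        qed
      qed
      also have "\<dots> = \<epsilon> / 2 + measure M A"
        by (subst Bochner_Integration.integral_add) (auto simp: prob_space emeasure_eq_measure)
      also have "\<dots> < \<epsilon>" using elim by (simp add: A_def)
      finally show ?case .
    qed
  next
    fix \<epsilon> :: real assume "\<epsilon> < 0"
    moreover have "expectation (D n) \<ge> 0" for n using D01 by (intro integral_nonneg_AE) auto
    ultimately show "\<forall>\<^sub>F n in sequentially. \<epsilon> < expectation (D n)"
      by (intro always_eventually allI) (rule less_le_trans)
  qed
  then have "(\<lambda>n. LINT \<omega>|M. norm (D n \<omega>)) \<longlonglongrightarrow> 0" using D01 by simp
  from tendsto_L1_AE_subseq[OF int this] obtain r where
    r: "strict_mono r" "AE \<omega> in M. (\<lambda>n. D (r n) \<omega>) \<longlonglongrightarrow> 0" by auto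
  have "AE \<omega> in M. (\<lambda>n. X (r n) \<omega>) \<longlonglongrightarrow> Y \<omega>"
    using r(2)
  proof eventually_elim
    case (elim \<omega>)
    \<comment> \<open>Below 1 the truncation is inactive.\<close>
    have "\<forall>\<^sub>F n in sequentially. D (r n) \<omega> < 1" using order_tendstoD(2)[OF elim] by simp
    then have "\<forall>\<^sub>F n in sequentially. D (r n) \<omega> = \<bar>X (r n) \<omega> - Y \<omega>\<bar>"
      by eventually_elim (auto simp: D_def)
    with elim have "(\<lambda>n. \<bar>X (r n) \<omega> - Y \<omega>\<bar>) \<longlonglongrightarrow> 0"
      by (rule Lim_transform_eventually)
    then show ?case by (simp add: tendsto_rabs_zero_iff LIM_zero_iff)
  qed
  with r(1) show ?thesis by blast
qed

section \<open>The put price as an expectation of Black-Scholes prices\<close>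

locale bns_model = prob_space M + black_scholes K r T
  for M :: "'a measure" and K r T :: real +
  fixes W Z :: "real \<Rightarrow> 'a \<Rightarrow> real" and Y :: "'a \<Rightarrow> real" and lam s0sq :: real
  assumes T_pos: "T > 0" and lam_pos: "lam > 0" and s0sq_pos: "s0sq > 0"
    and brownian: "brownian_motion M W" and subord: "subordinator M Z"
    and indep: "indep_var (Pi\<^sub>M {0..} (\<lambda>_. borel)) (\<lambda>\<omega>. \<lambda>t\<in>{0..}. W t \<omega>)
           (Pi\<^sub>M {0..} (\<lambda>_. borel)) (\<lambda>\<omega>. \<lambda>t\<in>{0..}. Z t \<omega>)"
    and Y_measurable [measurable]: "Y \<in> borel_measurable M"
    and Y_conv: "conv_in_prob M (dyadic_sum lam s0sq Z W T) Y"
begin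

lemma bns_path: "\<omega> \<in> space M \<Longrightarrow> bns_path M Z lam s0sq \<omega>"
  by unfold_locales (use subord lam_pos s0sq_pos in auto)

abbreviation "paths \<equiv> Pi\<^sub>M {0..} (\<lambda>_. borel) :: (real \<Rightarrow> real) measure"

definition grid :: "nat \<Rightarrow> nat \<Rightarrow> real" where "grid n i = real i * T / 2 ^ n"

definition V :: "nat \<Rightarrow> 'a \<Rightarrow> real" where
  "V n \<omega> = (\<Sum>i<2 ^ n. sigma2 lam s0sq Z (grid n i) \<omega> * (T / 2 ^ n))"

lemma grid_nonneg: "grid n i \<ge> 0" and grid_step: "grid n (Suc i) - grid n i = T / 2 ^ n"
  using T_pos by (auto simp: grid_def field_simps)

lemma dyadic_sum_eq:
  "dyadic_sum lam s0sq Z W T n \<omega> =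
    (\<Sum>i<2 ^ n. sqrt (sigma2 lam s0sq Z (grid n i) \<omega>) * (W (grid n (Suc i)) \<omega> - W (grid n i) \<omega>))"
  by (simp add: dyadic_sum_def grid_def)

lemma W_measurable [measurable]: "W t \<in> borel_measurable M"
  using brownian by (simp add: brownian_motion_def)

lemma Z_measurable [measurable]: "Z t \<in> borel_measurable M"
  using subord by (simp add: subordinator_def)

lemma sigma2_measurable:
  assumes "t \<ge> 0"
  shows "sigma2 lam s0sq Z t \<in> borel_measurable M"
proof -
  have "(\<lambda>\<omega>. path_variance lam s0sq t (\<lambda>t\<in>{0..}. Z t \<omega>)) \<in> borel_measurable M"
    using measurable_compose[OF indep_var_rv2[OF indep] path_variance_measurable[OF lam_pos assms]] .
  then show ?thesis
    by (subst measurable_cong[of _ _ "\<lambda>\<omega>. path_variance lam s0sq t (\<lambda>t\<in>{0..}. Z t \<omega>)"])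
      (auto simp: bns_path.path_variance_eq[OF bns_path assms])
qed

lemma V_measurable [measurable]: "V n \<in> borel_measurable M"
  unfolding V_def[abs_def]
  by (intro borel_measurable_sum borel_measurable_times borel_measurable_const sigma2_measurable grid_nonneg)

lemma dyadic_sum_measurable [measurable]: "dyadic_sum lam s0sq Z W T n \<in> borel_measurable M"
  unfolding dyadic_sum_eq[abs_def]
  by (intro borel_measurable_sum borel_measurable_times borel_measurable_diff W_measurable
      measurable_compose[OF sigma2_measurable[OF grid_nonneg] borel_measurable_sqrt])

lemma V_tendsto: "\<omega> \<in> space M \<Longrightarrow> (\<lambda>n. V n \<omega>) \<longlonglongrightarrow> intvar lam s0sq Z T \<omega>"
  using bns_path.intvar_riemann[OF bns_path T_pos] by (simp add: V_def grid_def)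

lemma intvar_measurable [measurable]: "intvar lam s0sq Z T \<in> borel_measurable M"
  by (rule borel_measurable_LIMSEQ_real[OF V_tendsto V_measurable])

lemma V_pos: "\<omega> \<in> space M \<Longrightarrow> V n \<omega> > 0"
  unfolding V_def using T_pos
  by (intro sum_pos mult_pos_pos bns_path.sigma2_pos[OF bns_path] grid_nonneg) (auto simp: lessThan_empty_iff)

lemma intvar_lower: "\<omega> \<in> space M \<Longrightarrow> exp (- lam * T) * s0sq * T \<le> intvar lam s0sq Z T \<omega>"
  by (rule bns_path.intvar_lower_bound[OF bns_path T_pos])

lemma intvar_pos: "\<omega> \<in> space M \<Longrightarrow> intvar lam s0sq Z T \<omega> > 0"
  using intvar_lower T_pos s0sq_pos by (meson exp_gt_zero less_le_trans mult_pos_pos)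

text \<open>The weights are deterministic: \<open>a i\<close> is the variance at a grid point after
  the path of \<open>Z\<close> has been frozen. Their positivity keeps the normal laws
  nondegenerate.\<close>

lemma brownian_weighted_sum_normal:
  assumes a: "\<And>i. a i > 0"
  shows "distributed M lborel (\<lambda>\<omega>. \<Sum>i<2 ^ n. sqrt (a i) * (W (grid n (Suc i)) \<omega> - W (grid n i) \<omega>))
    (normal_density 0 (sqrt (\<Sum>i<2 ^ n. a i * (T / 2 ^ n))))"
proof -
  \<comment> \<open>The \<open>2 ^ n\<close> increments need \<open>2 ^ n + 1\<close> grid
    points.\<close>
  define ts where "ts = map (grid n) [0..<2 ^ n + 1]"
  have ts: "ts ! i = grid n i" if "i \<le> 2 ^ n" for i
    using that by (simp add: ts_def nth_append del: upt_Suc)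
  have "sorted ts"
    using T_pos by (auto simp: ts_def sorted_wrt_iff_nth_less grid_def divide_right_mono mult_right_mono simp del: upt_Suc)
  moreover have "\<forall>t\<in>set ts. 0 \<le> t" by (auto simp: ts_def grid_nonneg)
  moreover have "indep_increments M W" using brownian by (simp add: brownian_motion_def)
  ultimately have "indep_vars (\<lambda>_. borel) (\<lambda>i \<omega>. W (ts ! Suc i) \<omega> - W (ts ! i) \<omega>) {..<length ts - 1}"
    unfolding indep_increments_def by blast
  then have "indep_vars (\<lambda>_. borel) (\<lambda>i \<omega>. W (ts ! Suc i) \<omega> - W (ts ! i) \<omega>) {..<2 ^ n}"
    by (simp add: ts_def)
  then have "indep_vars (\<lambda>_. borel) (\<lambda>i \<omega>. W (grid n (Suc i)) \<omega> - W (grid n i) \<omega>) {..<2 ^ n}"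
    by (rule indep_vars_cong[THEN iffD1, rotated 3]) (auto simp: ts fun_eq_iff)
  then have ind: "indep_vars (\<lambda>_. borel) (\<lambda>i \<omega>. sqrt (a i) * (W (grid n (Suc i)) \<omega> - W (grid n i) \<omega>)) {..<2 ^ n}"
    by (rule indep_vars_compose2[where Y="\<lambda>i x. sqrt (a i) * x"]) auto
  have "distributed M lborel (\<lambda>\<omega>. \<Sum>i<2 ^ n. sqrt (a i) * (W (grid n (Suc i)) \<omega> - W (grid n i) \<omega>))
    (normal_density (\<Sum>i<(2::nat) ^ n. 0) (sqrt (\<Sum>i<2 ^ n. (sqrt (a i) * sqrt (T / 2 ^ n))\<^sup>2)))"
  proof (rule sum_indep_normal[OF _ _ ind])
    fix i
    show "0 < sqrt (a i) * sqrt (T / 2 ^ n)" using a[of i] T_pos by simp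
    have "grid n (Suc i) - grid n i > 0" unfolding grid_step using T_pos by simp
    then have "grid n i < grid n (Suc i)" by simp
    then have "distributed M lborel (\<lambda>\<omega>. W (grid n (Suc i)) \<omega> - W (grid n i) \<omega>)
        (normal_density 0 (sqrt (grid n (Suc i) - grid n i)))"
      using brownian grid_nonneg unfolding brownian_motion_def by blast
    from normal_density_affine[OF this, of "sqrt (a i)" 0] a[of i] T_pos
    show "distributed M lborel (\<lambda>\<omega>. sqrt (a i) * (W (grid n (Suc i)) \<omega> - W (grid n i) \<omega>))
       (normal_density 0 (sqrt (a i) * sqrt (T / 2 ^ n)))"
      by (simp add: grid_step)
  qed (auto simp: lessThan_empty_iff)
  moreover have "(sqrt (a i) * sqrt (T / 2 ^ n))\<^sup>2 = a i * (T / 2 ^ n)" for i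
    using a[of i] T_pos by (simp add: power_mult_distrib)
  ultimately show ?thesis by simp
qed

lemma expectation_put_normal:
  assumes N: "distributed M lborel X (normal_density 0 (sqrt v))" and "v > 0" "x > 0"
  shows "expectation (\<lambda>\<omega>. max (K - x * exp (r * T - v / 2 + X \<omega>)) 0) = exp (r * T) * BS_put K r T x v"
  using distributed_integral[OF N, of "\<lambda>z. max (K - x * exp (r * T - v / 2 + z)) 0"]
    put_payoff_normal_expectation[OF \<open>x > 0\<close> \<open>v > 0\<close>] by simp

text \<open>By independence the joint law of the two paths is a product. For a frozen path of
  \<open>Z\<close> the spot \<open>x\<close>, the weights and \<open>V n\<close> are constants, and
  the inner expectation is the Black-Scholes formula.\<close>

lemma expectation_put_dyadic:
  fixes S0 \<rho> c :: real
  assumes S0: "S0 > 0"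
  defines "x \<equiv> \<lambda>\<omega>. S0 * exp (\<rho> * Z (lam * T) \<omega> - c)"
  shows "expectation (\<lambda>\<omega>. max (K - x \<omega> * exp (r * T - V n \<omega> / 2 + dyadic_sum lam s0sq Z W T n \<omega>)) 0)
    = expectation (\<lambda>\<omega>. exp (r * T) * BS_put K r T (x \<omega>) (V n \<omega>))"
proof -
  define Wr where "Wr \<omega> = (\<lambda>t\<in>{0..}. W t \<omega>)" for \<omega>
  define Zr where "Zr \<omega> = (\<lambda>t\<in>{0..}. Z t \<omega>)" for \<omega>
  have ind: "indep_var paths Wr paths Zr" using indep unfolding Wr_def Zr_def .
  have Wr [measurable]: "Wr \<in> M \<rightarrow>\<^sub>M paths" and Zr [measurable]: "Zr \<in> M \<rightarrow>\<^sub>M paths"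
    using indep_var_rv1[OF ind] indep_var_rv2[OF ind] .
  interpret DW: prob_space "distr M paths Wr" by (rule prob_space_distr) (rule Wr)
  interpret DZ: prob_space "distr M paths Zr" by (rule prob_space_distr) (rule Zr)
  interpret P: pair_prob_space "distr M paths Wr" "distr M paths Zr" ..
  define a where "a i z = path_variance lam s0sq (grid n i) z" for i z
  define v where "v z = (\<Sum>i<2 ^ n. a i z * (T / 2 ^ n))" for z
  define xz where "xz z = S0 * exp (\<rho> * z (lam * T) - c)" for z :: "real \<Rightarrow> real"
  define G where "G w z = max (K - xz z * exp (r * T - v z / 2 +
     (\<Sum>i<2 ^ n. sqrt (a i z) * (w (grid n (Suc i)) - w (grid n i))))) 0" for w z
  have comp: "(\<lambda>w. w u) \<in> borel_measurable paths" if "u \<ge> 0" for u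
    using that by (intro measurable_component_singleton) auto
  have w_grid [measurable]: "(\<lambda>w. w (grid n i)) \<in> borel_measurable paths" for i
    by (rule comp[OF grid_nonneg])
  have a_meas [measurable]: "a i \<in> borel_measurable paths" for i
    unfolding a_def by (rule path_variance_measurable[OF lam_pos grid_nonneg])
  have v_meas [measurable]: "v \<in> borel_measurable paths" unfolding v_def[abs_def] by measurable
  have [measurable]: "(\<lambda>z. z (lam * T)) \<in> borel_measurable paths"
    using lam_pos T_pos by (intro comp) simp
  have xz_meas [measurable]: "xz \<in> borel_measurable paths" unfolding xz_def[abs_def] by measurable
  have [measurable]: "(\<lambda>p. fst p (grid n i)) \<in> borel_measurable (paths \<Otimes>\<^sub>M paths)" for i
    using measurable_compose[OF measurable_fst w_grid] .
  have G_meas [measurable]: "(\<lambda>(w, z). G w z) \<in> borel_measurable (paths \<Otimes>\<^sub>M paths)"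
    unfolding G_def split_beta by measurable
  have G1_meas: "(\<lambda>w. G w z) \<in> borel_measurable paths" for z
    unfolding G_def by measurable
  have G_bound: "norm (G w z) \<le> K" for w z
    using S0 K_pos by (auto simp: G_def xz_def)
  have a_pos: "a i z > 0" for i z unfolding a_def by (rule path_variance_pos[OF s0sq_pos])
  have v_pos: "v z > 0" for z unfolding v_def using a_pos T_pos by (intro sum_pos) (auto simp: lessThan_empty_iff)
  have xz_pos: "xz z > 0" for z using S0 by (simp add: xz_def)
  have G_Zr: "G (Wr \<omega>) (Zr \<omega>) = max (K - x \<omega> * exp (r * T - V n \<omega> / 2 + dyadic_sum lam s0sq Z W T n \<omega>)) 0"
    and BS_Zr: "xz (Zr \<omega>) = x \<omega>" "v (Zr \<omega>) = V n \<omega>" if "\<omega> \<in> space M" for \<omega>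
  proof -
    have a: "a i (Zr \<omega>) = sigma2 lam s0sq Z (grid n i) \<omega>" for i
      unfolding a_def Zr_def by (rule bns_path.path_variance_eq[OF bns_path[OF that] grid_nonneg])
    show v: "v (Zr \<omega>) = V n \<omega>" by (simp add: v_def V_def a)
    show xx: "xz (Zr \<omega>) = x \<omega>" using lam_pos T_pos by (simp add: xz_def x_def Zr_def)
    have "Wr \<omega> (grid n i) = W (grid n i) \<omega>" for i using grid_nonneg by (simp add: Wr_def)
    then show "G (Wr \<omega>) (Zr \<omega>) = max (K - x \<omega> * exp (r * T - V n \<omega> / 2 + dyadic_sum lam s0sq Z W T n \<omega>)) 0"
      by (simp add: G_def v xx a dyadic_sum_eq)
  qed
  have "expectation (\<lambda>\<omega>. max (K - x \<omega> * exp (r * T - V n \<omega> / 2 + dyadic_sum lam s0sq Z W T n \<omega>)) 0)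
      = expectation (\<lambda>\<omega>. (\<lambda>(w, z). G w z) (Wr \<omega>, Zr \<omega>))"
    by (intro Bochner_Integration.integral_cong) (auto simp: G_Zr)
  also have "\<dots> = (LINT p|(distr M (paths \<Otimes>\<^sub>M paths) (\<lambda>\<omega>. (Wr \<omega>, Zr \<omega>))). (\<lambda>(w, z). G w z) p)"
    by (rule integral_distr[symmetric]) measurable
  also have "distr M (paths \<Otimes>\<^sub>M paths) (\<lambda>\<omega>. (Wr \<omega>, Zr \<omega>)) = distr M paths Wr \<Otimes>\<^sub>M distr M paths Zr"
    using ind unfolding indep_var_distribution_eq by simp
  \<comment> \<open>The Brownian path is integrated out first; \<open>K\<close> bounds
    \<open>G\<close>, which justifies Fubini.\<close>
  also have "(LINT p|(distr M paths Wr \<Otimes>\<^sub>M distr M paths Zr). (\<lambda>(w, z). G w z) p)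
      = (LINT z|distr M paths Zr. LINT w|distr M paths Wr. G w z)"
    by (rule P.integral_snd[symmetric], rule P.integrable_const_bound[where B=K]) (use G_bound in auto)
  also have "\<dots> = (LINT z|distr M paths Zr. exp (r * T) * BS_put K r T (xz z) (v z))"
  proof (rule Bochner_Integration.integral_cong[OF refl])
    fix z
    \<comment> \<open>Back on \<open>M\<close>, where the Gaussian increments of \<open>W\<close>
      are available, but with \<open>z\<close> fixed.\<close>
    have "(LINT w|distr M paths Wr. G w z) = expectation (\<lambda>\<omega>. G (Wr \<omega>) z)"
      by (rule integral_distr[OF Wr G1_meas])
    also have "\<dots> = exp (r * T) * BS_put K r T (xz z) (v z)"
      using expectation_put_normal[OF brownian_weighted_sum_normal[where a="\<lambda>i. a i z"] _ xz_pos] a_pos v_pos[of z] grid_nonneg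
      by (simp add: G_def Wr_def v_def)
    finally show "(LINT w|distr M paths Wr. G w z) = exp (r * T) * BS_put K r T (xz z) (v z)" .
  qed
  also have "\<dots> = expectation (\<lambda>\<omega>. exp (r * T) * BS_put K r T (xz (Zr \<omega>)) (v (Zr \<omega>)))"
    by (rule integral_distr[OF Zr]) measurable
  also have "\<dots> = expectation (\<lambda>\<omega>. exp (r * T) * BS_put K r T (x \<omega>) (V n \<omega>))"
    by (intro Bochner_Integration.integral_cong) (auto simp: BS_Zr)
  finally show ?thesis .
qed

end

text \<open>The lower bound is not visible in the formula; it comes from the Gaussian expectation of
  a nonnegative payoff.\<close>

lemma (in black_scholes) BS_put_bounds:
  assumes "x > 0" "y > 0"
  shows "0 \<le> BS_put K r T x y" "BS_put K r T x y \<le> K * exp (- r * T)"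
proof -
  have "0 \<le> exp (r * T) * BS_put K r T x y"
    unfolding put_payoff_normal_expectation[OF assms, symmetric]
    by (intro integral_nonneg_AE AE_I2) auto
  then show "0 \<le> BS_put K r T x y" by (simp add: zero_le_mult_iff)
  have "K * exp (- r * T) * Phi (- dm x y) \<le> K * exp (- r * T)"
    using mult_left_mono[OF Phi_le_1, of "K * exp (- r * T)"] K_pos by simp
  moreover have "0 \<le> x * Phi (- d_plus K r T x y)" using assms Phi_nonneg by simp
  ultimately show "BS_put K r T x y \<le> K * exp (- r * T)" unfolding BS_put_def by linarith
qed

lemma (in black_scholes) abs_forward_BS_put_le:
  assumes "x > 0" "y > 0"
  shows "\<bar>exp (r * T) * BS_put K r T x y\<bar> \<le> K"
proof -
  have "exp (r * T) * BS_put K r T x y \<le> exp (r * T) * (K * exp (- r * T))"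
    by (intro mult_left_mono BS_put_bounds assms) auto
  also have "\<dots> = K" by (simp add: exp_minus)
  finally show ?thesis using BS_put_bounds(1)[OF assms] by simp
qed

context bns_model
begin

text \<open>Both sides of the dyadic identity converge along a subsequence on which the sums tend to
  \<open>Y\<close> almost surely: the payoffs are bounded by \<open>K\<close>, and so are the
  undiscounted Black-Scholes prices.\<close>

lemma put_price:
  fixes S0 \<rho> c :: real
  assumes S0: "S0 > 0"
  defines "x \<equiv> \<lambda>\<omega>. S0 * exp (\<rho> * Z (lam * T) \<omega> - c)"
  shows "expectation (\<lambda>\<omega>. exp (- r * T) * max (K - x \<omega> * exp (r * T - intvar lam s0sq Z T \<omega> / 2 + Y \<omega>)) 0)
    = expectation (\<lambda>\<omega>. BS_put K r T (x \<omega>) (intvar lam s0sq Z T \<omega>))"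
proof -
  obtain q :: "nat \<Rightarrow> nat" where q: "strict_mono q"
    "AE \<omega> in M. (\<lambda>n. dyadic_sum lam s0sq Z W T (q n) \<omega>) \<longlonglongrightarrow> Y \<omega>"
    using conv_in_prob_AE_subseq[OF dyadic_sum_measurable Y_measurable Y_conv] by blast
  have x [measurable]: "x \<in> borel_measurable M" unfolding x_def by measurable
  have x_pos: "x \<omega> > 0" for \<omega> using S0 by (simp add: x_def)
  have Vq: "(\<lambda>n. V (q n) \<omega>) \<longlonglongrightarrow> intvar lam s0sq Z T \<omega>" if "\<omega> \<in> space M" for \<omega>
    using LIMSEQ_subseq_LIMSEQ[OF V_tendsto[OF that] q(1)] by (simp add: o_def)
  have "(\<lambda>n. expectation (\<lambda>\<omega>. max (K - x \<omega> * exp (r * T - V (q n) \<omega> / 2 + dyadic_sum lam s0sq Z W T (q n) \<omega>)) 0))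
    \<longlonglongrightarrow> expectation (\<lambda>\<omega>. max (K - x \<omega> * exp (r * T - intvar lam s0sq Z T \<omega> / 2 + Y \<omega>)) 0)"
  proof (rule integral_dominated_convergence[where w="\<lambda>_. K"])
    show "AE \<omega> in M. (\<lambda>n. max (K - x \<omega> * exp (r * T - V (q n) \<omega> / 2 + dyadic_sum lam s0sq Z W T (q n) \<omega>)) 0)
      \<longlonglongrightarrow> max (K - x \<omega> * exp (r * T - intvar lam s0sq Z T \<omega> / 2 + Y \<omega>)) 0"
      using q(2) AE_space by eventually_elim (intro tendsto_intros Vq; simp)
    show "AE \<omega> in M. norm (max (K - x \<omega> * exp (r * T - V (q n) \<omega> / 2 + dyadic_sum lam s0sq Z W T (q n) \<omega>)) 0) \<le> K" for n
      using K_pos x_pos by (intro AE_I2) (auto simp: max_def less_imp_le)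
  qed auto
  moreover have "(\<lambda>n. expectation (\<lambda>\<omega>. exp (r * T) * BS_put K r T (x \<omega>) (V (q n) \<omega>)))
    \<longlonglongrightarrow> expectation (\<lambda>\<omega>. exp (r * T) * BS_put K r T (x \<omega>) (intvar lam s0sq Z T \<omega>))"
  proof (rule integral_dominated_convergence[where w="\<lambda>_. K"])
    show "AE \<omega> in M. (\<lambda>n. exp (r * T) * BS_put K r T (x \<omega>) (V (q n) \<omega>))
      \<longlonglongrightarrow> exp (r * T) * BS_put K r T (x \<omega>) (intvar lam s0sq Z T \<omega>)"
      using AE_space
    proof eventually_elim
      case (elim \<omega>)
      have "isCont (BS_put K r T (x \<omega>)) (intvar lam s0sq Z T \<omega>)"
        using total_diffD(2)[OF total_diff_BS_put x_pos intvar_pos[OF elim]] by (rule DERIV_isCont)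
      from isCont_tendsto_compose[OF this Vq[OF elim]] show ?case by (intro tendsto_intros)
    qed
    show "AE \<omega> in M. norm (exp (r * T) * BS_put K r T (x \<omega>) (V (q n) \<omega>)) \<le> K" for n
      using abs_forward_BS_put_le[OF x_pos V_pos] by (intro AE_I2) simp
  qed auto
  ultimately have "expectation (\<lambda>\<omega>. max (K - x \<omega> * exp (r * T - intvar lam s0sq Z T \<omega> / 2 + Y \<omega>)) 0) =
    expectation (\<lambda>\<omega>. exp (r * T) * BS_put K r T (x \<omega>) (intvar lam s0sq Z T \<omega>))"
    using expectation_put_dyadic[OF S0, of \<rho> c] unfolding x_def by (intro LIMSEQ_unique) auto
  then have "exp (- r * T) * expectation (\<lambda>\<omega>. max (K - x \<omega> * exp (r * T - intvar lam s0sq Z T \<omega> / 2 + Y \<omega>)) 0) =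
    exp (- r * T) * (exp (r * T) * expectation (\<lambda>\<omega>. BS_put K r T (x \<omega>) (intvar lam s0sq Z T \<omega>)))"
    by simp
  also have "\<dots> = expectation (\<lambda>\<omega>. BS_put K r T (x \<omega>) (intvar lam s0sq Z T \<omega>))"
    by (simp add: exp_minus)
  finally show ?thesis by simp
qed

end

subsection \<open>The Taylor remainder\<close>

text \<open>The integral runs over the open interval, so the endpoint \<open>u = 1\<close>, which
  the kernel bound excludes, is never met.\<close>

lemma LBINT_0_1: "(LBINT u=0..1. f u) = (LINT u|lborel. indicator {0<..<1} u * f u)" for f :: "real \<Rightarrow> real"
  by (simp add: interval_lebesgue_integral_def set_lebesgue_integral_def zero_ereal_def one_ereal_def)

lemma segment_pos:
  fixes p q u :: real
  assumes "p > 0" "q > 0" "u \<in> {0..1}"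
  shows "(1 - u) * p + u * q > 0"
  using assms by (cases "u = 0") (auto intro!: add_nonneg_pos)

lemma segment_ge:
  fixes p q u d :: real
  assumes "p \<ge> d" "q \<ge> d" "u \<in> {0..1}"
  shows "(1 - u) * p + u * q \<ge> d"
proof -
  have "(1 - u) * d + u * d \<le> (1 - u) * p + u * q"
    using assms by (intro add_mono mult_left_mono) auto
  then show ?thesis by (simp add: algebra_simps)
qed

context black_scholes
begin

text \<open>The bound is uniform in \<open>p\<close> because the kernel estimate only uses that the
  first coordinate is at least \<open>(1 - u) * x0\<close>; the second stays above
  \<open>\<delta>\<close> by convexity.\<close>

lemma taylor_remainder_bounded:
  assumes ab: "a + b = N + 1" "N \<ge> 1" and pos: "x0 > 0" "\<delta> > 0" "y0 \<ge> \<delta>"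
  shows "\<exists>C\<ge>0. \<forall>p>0. \<forall>y1\<ge>\<delta>. \<bar>LBINT u=0..1. (1 - u) ^ N *
      mixed_partial a b (BS_put K r T) ((1 - u) * x0 + u * p * x0) ((1 - u) * y0 + u * y1)\<bar> \<le> C"
proof -
  let ?f = "\<lambda>p y1 u. (1 - u) ^ N * mixed_partial a b (BS_put K r T) ((1 - u) * x0 + u * p * x0) ((1 - u) * y0 + u * y1)"
  from remainder_kernel_bound[OF ab pos(1,2)] obtain C where C: "C \<ge> 0"
    "\<And>u x y. u \<in> {0..<1} \<Longrightarrow> x \<ge> (1 - u) * x0 \<Longrightarrow> y \<ge> \<delta> \<Longrightarrow>
      \<bar>(1 - u) ^ N * mixed_partial a b (BS_put K r T) x y\<bar> \<le> C" by blast
  have "\<bar>LBINT u=0..1. ?f p y1 u\<bar> \<le> C" if p: "p > 0" and y1: "y1 \<ge> \<delta>" for p y1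
  proof -
    have "\<bar>LINT u|lborel. indicator {0<..<1} u * ?f p y1 u\<bar> \<le> (LINT u|lborel. \<bar>indicator {0<..<1} u * ?f p y1 u\<bar>)"
      by (rule integral_abs_bound)
    also have "\<dots> \<le> (LINT u|lborel. C * indicator {0<..<1::real} u)"
    proof (rule integral_mono')
      fix u :: real
      show "\<bar>indicator {0<..<1} u * ?f p y1 u\<bar> \<le> C * indicator {0<..<1} u"
      proof (cases "u \<in> {0<..<1}")
        case True
        have "\<bar>?f p y1 u\<bar> \<le> C"
          using True p pos y1 by (intro C(2) segment_ge) auto
        then show ?thesis using True by simp
      qed simp
    qed (use C(1) in auto)
    also have "\<dots> = C" by simp
    finally show ?thesis unfolding LBINT_0_1 .
  qed
  with C(1) show ?thesis by blast
qed

lemma taylor_remainder_measurable: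
  assumes P [measurable]: "P \<in> borel_measurable M" and I [measurable]: "I \<in> borel_measurable M"
    and pos: "\<And>\<omega>. \<omega> \<in> space M \<Longrightarrow> P \<omega> > 0" "\<And>\<omega>. \<omega> \<in> space M \<Longrightarrow> I \<omega> > 0" "x0 > 0" "y0 > 0"
  shows "(\<lambda>\<omega>. LBINT u=0..1. (1 - u) ^ N * mixed_partial a b (BS_put K r T)
      ((1 - u) * x0 + u * P \<omega> * x0) ((1 - u) * y0 + u * I \<omega>)) \<in> borel_measurable M"
proof -
  let ?Q = "{0<..} \<times> {0<..} :: (real \<times> real) set"
  \<comment> \<open>Outside the quadrant \<open>deriv\<close> gives no control, so the derivative is
    cut off to 0 there; continuity on the open quadrant then makes \<open>D\<close> a Borel function
    on the plane.\<close>
  define D where "D p = indicator ?Q p *\<^sub>R mixed_partial a b (BS_put K r T) (fst p) (snd p)" for p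
  have D [measurable]: "D \<in> borel_measurable borel"
    unfolding D_def
    by (intro borel_measurable_continuous_on_indicator total_diff_continuous_on smooth_quadrantD
        smooth_mixed_partial smooth_BS_put) (auto intro!: borel_open open_Times)
  have "(\<lambda>\<omega>. LINT u|lborel. indicator {0<..<1} u * ((1 - u) ^ N *
      D ((1 - u) * x0 + u * P \<omega> * x0, (1 - u) * y0 + u * I \<omega>))) \<in> borel_measurable M"
    by measurable
  also have "?this \<longleftrightarrow> ?thesis"
    unfolding LBINT_0_1
  proof (intro measurable_cong Bochner_Integration.integral_cong refl)
    fix \<omega> u assume \<omega>: "\<omega> \<in> space M"
    have "(1 - u) * x0 + u * (P \<omega> * x0) > 0" "(1 - u) * y0 + u * I \<omega> > 0" if "u \<in> {0<..<1}"
      using that pos \<omega> by (intro segment_pos; simp)+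
    then show "indicator {0<..<1} u * ((1 - u) ^ N * D ((1 - u) * x0 + u * P \<omega> * x0, (1 - u) * y0 + u * I \<omega>))
      = indicator {0<..<1} u * ((1 - u) ^ N * mixed_partial a b (BS_put K r T) ((1 - u) * x0 + u * P \<omega> * x0) ((1 - u) * y0 + u * I \<omega>))"
      by (auto simp: D_def indicator_def mult.assoc)
  qed
  finally show ?thesis .
qed

end

section \<open>Expectation of the Taylor formula\<close>

theorem mainTheorem1:
  fixes M :: "'a measure"
    and W Z :: "real \<Rightarrow> 'a \<Rightarrow> real"
    and Y :: "'a \<Rightarrow> real"
    and T r lam s0sq S0 K \<rho> :: real
    and N :: nat
  assumes "prob_space M"
    and "T > 0" and "lam > 0" and "s0sq > 0" and "S0 > 0" and "K > 0"
    and "brownian_motion M W"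
    and "subordinator M Z"
    and "prob_space.indep_var M
           (Pi\<^sub>M {0..} (\<lambda>_. borel)) (\<lambda>\<omega>. \<lambda>t\<in>{0..}. W t \<omega>)
           (Pi\<^sub>M {0..} (\<lambda>_. borel)) (\<lambda>\<omega>. \<lambda>t\<in>{0..}. Z t \<omega>)"
    and "kappa_hat M Z > 0" and "ereal \<rho> < kappa_hat M Z"
    and "Y \<in> borel_measurable M"
    and "conv_in_prob M (dyadic_sum lam s0sq Z W T) Y"
    and "N \<ge> 1"
  defines "P \<equiv> (\<lambda>\<omega>. exp (\<rho> * Z (lam * T) \<omega> - lam * T * kappa M Z \<rho>))"
    and "I \<equiv> intvar lam s0sq Z T"
    and "EI \<equiv> integral\<^sup>L M (intvar lam s0sq Z T)"
    and "S \<equiv> (\<lambda>\<omega>. S0 * exp (\<rho> * Z (lam * T) \<omega> - lam * T * kappa M Z \<rho>) * exp (r * T - intvar lam s0sq Z T \<omega> / 2 + Y \<omega>))"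
  assumes "\<forall>n\<in>{1..N+1}. \<forall>k\<le>n.
             integrable M (\<lambda>\<omega>. \<bar>P \<omega> - 1\<bar> ^ (n - k) * \<bar>I \<omega> - EI\<bar> ^ k)"
  shows "(\<forall>n\<le>N+1. integrable M (\<lambda>\<omega>. (P \<omega> - 1) ^ (N + 1 - n) * (I \<omega> - EI) ^ n *
            (LBINT u=0..1. (1 - u) ^ N *
               mixed_partial (N + 1 - n) n (BS_put K r T)
                 ((1 - u) * S0 + u * P \<omega> * S0) ((1 - u) * EI + u * I \<omega>))))
    \<and> (AE \<omega> in M. \<forall>u\<in>{0..1}. (1 - u) * S0 + u * P \<omega> * S0 > 0 \<and> (1 - u) * EI + u * I \<omega> > 0)
    \<and> EI > 0
    \<and> integral\<^sup>L M (\<lambda>\<omega>. exp (- r * T) * max (K - S \<omega>) 0)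
      = (BS_put K r T S0 EI
         + (\<Sum>n=2..N. 1 / fact n * (\<Sum>k=0..n. real (n choose k) * S0 ^ (n - k) *
              integral\<^sup>L M (\<lambda>\<omega>. (P \<omega> - 1) ^ (n - k) * (I \<omega> - EI) ^ k) *
              mixed_partial (n - k) k (BS_put K r T) S0 EI)))
        + 1 / fact N * (\<Sum>n=0..N+1. real ((N + 1) choose n) * S0 ^ (N + 1 - n) *
              integral\<^sup>L M (\<lambda>\<omega>. (P \<omega> - 1) ^ (N + 1 - n) * (I \<omega> - EI) ^ n *
                (LBINT u=0..1. (1 - u) ^ N *
                   mixed_partial (N + 1 - n) n (BS_put K r T)
                     ((1 - u) * S0 + u * P \<omega> * S0) ((1 - u) * EI + u * I \<omega>))))"
proof -
  interpret prob_space M by fact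
  interpret bns_model M K r T W Z Y lam s0sq
    by unfold_locales (use assms in auto)
  note S0 = \<open>S0 > 0\<close> and N = \<open>N \<ge> 1\<close>
  have P_meas [measurable]: "P \<in> borel_measurable M" unfolding P_def by measurable
  have I_meas [measurable]: "I \<in> borel_measurable M" unfolding I_def by measurable
  define A where "A n k \<omega> = (P \<omega> - 1) ^ (n - k) * (I \<omega> - EI) ^ k" for n k \<omega>
  have A_int: "integrable M (A n k)" if "n \<le> N + 1" "k \<le> n" for n k
  \<comment> \<open>The assumed moments start at order 1; for order 0 the integrand is the constant
    1.\<close>
  proof (cases "n = 0")
    case True
    then show ?thesis using that by (simp add: A_def[abs_def])
  next
    case False
    then have "integrable M (\<lambda>\<omega>. \<bar>A n k \<omega>\<bar>)"
      using assms(19) that by (simp add: A_def abs_mult power_abs)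
    then show ?thesis
      by (rule integrable_abs_cancel) (simp add: A_def[abs_def])
  qed
  \<comment> \<open>The moment with \<open>n = k = 1\<close> makes \<open>I - EI\<close> integrable,
    hence \<open>I\<close>. Only now is \<open>EI\<close> known to be a true mean and not the
    default value 0 of the integral.\<close>
  have I_int: "integrable M I"
    using Bochner_Integration.integrable_add[OF A_int[of 1 1] integrable_const[of EI]] N by (simp add: A_def)
  have P_int: "integrable M P" and EP: "expectation P = 1"
  proof -
    have lt: "lam * T \<ge> 0" using \<open>lam > 0\<close> \<open>T > 0\<close> by simp
    note mgf = subordinator_mgf[OF \<open>subordinator M Z\<close> \<open>ereal \<rho> < kappa_hat M Z\<close> lt]
    show "integrable M P" unfolding P_def exp_diff using mgf(1) by simp
    show "expectation P = 1" unfolding P_def exp_diff using mgf(2) by simp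
  qed
  define \<delta> where "\<delta> = exp (- lam * T) * s0sq * T"
  have \<delta>: "\<delta> > 0" using assms(2,4) by (simp add: \<delta>_def)
  have I_ge: "I \<omega> \<ge> \<delta>" if "\<omega> \<in> space M" for \<omega>
    unfolding I_def \<delta>_def by (rule intvar_lower[OF that])
  have EI_ge: "EI \<ge> \<delta>"
    unfolding EI_def I_def[symmetric] using I_ge by (intro integral_ge_const I_int AE_I2)
  have EI_pos: "EI > 0" using EI_ge \<delta> by simp
  have P_pos: "P \<omega> > 0" for \<omega> by (simp add: P_def)
  have seg: "AE \<omega> in M. \<forall>u\<in>{0..1}. (1 - u) * S0 + u * P \<omega> * S0 > 0 \<and> (1 - u) * EI + u * I \<omega> > 0"
  proof (intro AE_I2 ballI conjI)
    fix \<omega> u assume \<omega>: "\<omega> \<in> space M" and u: "u \<in> {0..1::real}"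
    show "(1 - u) * S0 + u * P \<omega> * S0 > 0"
      using segment_pos[OF S0 _ u, of "P \<omega> * S0"] P_pos S0 by (simp add: mult.assoc)
    show "(1 - u) * EI + u * I \<omega> > 0"
      using segment_pos[OF EI_pos _ u] I_ge[OF \<omega>] \<delta> by simp
  qed
  define J where "J n \<omega> = (LBINT u=0..1. (1 - u) ^ N * mixed_partial (N + 1 - n) n (BS_put K r T)
                     ((1 - u) * S0 + u * P \<omega> * S0) ((1 - u) * EI + u * I \<omega>))" for n \<omega>
  \<comment> \<open>\<open>J n\<close> is bounded by a constant, so the moments of order
    \<open>N + 1\<close> suffice.\<close>
  have AJ_int: "integrable M (\<lambda>\<omega>. A (N + 1) n \<omega> * J n \<omega>)" if "n \<le> N + 1" for n
  proof -
    have "N + 1 - n + n = N + 1" using that by simp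
    from taylor_remainder_bounded[OF this N S0 \<delta> EI_ge] obtain C where
      C: "C \<ge> 0" "\<And>\<omega>. \<omega> \<in> space M \<Longrightarrow> \<bar>J n \<omega>\<bar> \<le> C"
      unfolding J_def using P_pos I_ge by blast
    have J_meas [measurable]: "J n \<in> borel_measurable M"
      unfolding J_def[abs_def]
      by (intro taylor_remainder_measurable) (use P_pos S0 EI_pos I_ge \<delta> in \<open>auto intro: less_le_trans\<close>)
    show ?thesis
    proof (rule Bochner_Integration.integrable_bound)
      show "integrable M (\<lambda>\<omega>. A (N + 1) n \<omega> * C)" using A_int that by simp
      show "AE \<omega> in M. norm (A (N + 1) n \<omega> * J n \<omega>) \<le> norm (A (N + 1) n \<omega> * C)"
        using C by (intro AE_I2) (auto simp: abs_mult intro!: mult_left_mono)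
      show "(\<lambda>\<omega>. A (N + 1) n \<omega> * J n \<omega>) \<in> borel_measurable M"
        unfolding A_def by measurable
    qed
  qed
  define D where "D n k = mixed_partial (n - k) k (BS_put K r T) S0 EI" for n k
  have taylor: "BS_put K r T (S0 * P \<omega>) (I \<omega>) =
    (\<Sum>n\<le>N. 1 / fact n * (\<Sum>k\<le>n. real (n choose k) * S0 ^ (n - k) * D n k * A n k \<omega>))
    + 1 / fact N * (\<Sum>k\<le>N + 1. real ((N + 1) choose k) * S0 ^ (N + 1 - k) * (A (N + 1) k \<omega> * J k \<omega>))"
    if \<omega>: "\<omega> \<in> space M" for \<omega>
  proof -
    have 1: "P \<omega> * S0 > 0" "I \<omega> > 0" using P_pos S0 I_ge[OF \<omega>] \<delta> by auto
    \<comment> \<open>This factorisation is the origin of the powers of \<open>S0\<close> in the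
      expansion.\<close>
    have 2: "P \<omega> * S0 - S0 = S0 * (P \<omega> - 1)" by (simp add: algebra_simps)
    show ?thesis
      using taylor_quadrant[OF smooth_BS_put S0 EI_pos 1]
      unfolding 2 Suc_eq_plus1 power_mult_distrib A_def J_def D_def
      by (simp only: mult_ac)
  qed
  have "expectation (\<lambda>\<omega>. exp (- r * T) * max (K - S \<omega>) 0) = expectation (\<lambda>\<omega>. BS_put K r T (S0 * P \<omega>) (I \<omega>))"
    using put_price[OF S0, of \<rho> "lam * T * kappa M Z \<rho>"] by (simp add: S_def P_def I_def)
  also have "\<dots> = expectation (\<lambda>\<omega>. (\<Sum>n\<le>N. 1 / fact n * (\<Sum>k\<le>n. real (n choose k) * S0 ^ (n - k) * D n k * A n k \<omega>))
    + 1 / fact N * (\<Sum>k\<le>N + 1. real ((N + 1) choose k) * S0 ^ (N + 1 - k) * (A (N + 1) k \<omega> * J k \<omega>)))"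
    by (intro Bochner_Integration.integral_cong refl taylor)
  also have "\<dots> = (\<Sum>n\<le>N. 1 / fact n * (\<Sum>k\<le>n. real (n choose k) * S0 ^ (n - k) * D n k * expectation (A n k)))
    + 1 / fact N * (\<Sum>k\<le>N + 1. real ((N + 1) choose k) * S0 ^ (N + 1 - k) * expectation (\<lambda>\<omega>. A (N + 1) k \<omega> * J k \<omega>))"
  proof -
    have A: "has_bochner_integral M (A n k) (expectation (A n k))" if "n \<in> {..N}" "k \<in> {..n}" for n k
      using that by (intro has_bochner_integral_integrable A_int) auto
    have AJ: "has_bochner_integral M (\<lambda>\<omega>. A (N + 1) k \<omega> * J k \<omega>) (expectation (\<lambda>\<omega>. A (N + 1) k \<omega> * J k \<omega>))"
      if "k \<in> {..N + 1}" for k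
      using that by (intro has_bochner_integral_integrable AJ_int) auto
    show ?thesis
      by (intro has_bochner_integral_integral_eq has_bochner_integral_add has_bochner_integral_mult_right
          has_bochner_integral_sum A AJ)
  qed
  also have "(\<Sum>n\<le>N. 1 / fact n * (\<Sum>k\<le>n. real (n choose k) * S0 ^ (n - k) * D n k * expectation (A n k)))
    = BS_put K r T S0 EI + (\<Sum>n=2..N. 1 / fact n * (\<Sum>k\<le>n. real (n choose k) * S0 ^ (n - k) * D n k * expectation (A n k)))"
  proof -
    define t where "t n = 1 / fact n * (\<Sum>k\<le>n. real (n choose k) * S0 ^ (n - k) * D n k * expectation (A n k))" for n
    have "t 0 = BS_put K r T S0 EI"
      by (simp add: t_def D_def A_def[abs_def] prob_space)
    moreover have "t 1 = 0"
    proof -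
      have "expectation (A 1 0) = 0" "expectation (A 1 1) = 0"
        using P_int EP I_int by (simp_all add: A_def[abs_def] EI_def I_def prob_space)
      then show ?thesis by (simp add: t_def)
    qed
    moreover have "{..N} = insert 0 (insert 1 {2..N})" using N by auto
    then have "(\<Sum>n\<le>N. t n) = t 0 + (t 1 + (\<Sum>n=2..N. t n))"
      by (simp del: One_nat_def)
    ultimately show ?thesis by (simp add: t_def)
  qed
  finally have price: "expectation (\<lambda>\<omega>. exp (- r * T) * max (K - S \<omega>) 0) =
    BS_put K r T S0 EI + (\<Sum>n=2..N. 1 / fact n * (\<Sum>k\<le>n. real (n choose k) * S0 ^ (n - k) * D n k * expectation (A n k)))
    + 1 / fact N * (\<Sum>k\<le>N + 1. real ((N + 1) choose k) * S0 ^ (N + 1 - k) * expectation (\<lambda>\<omega>. A (N + 1) k \<omega> * J k \<omega>))" .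
  have swap: "(\<Sum>k\<le>n. real (n choose k) * S0 ^ (n - k) * D n k * expectation (A n k)) =
    (\<Sum>k=0..n. real (n choose k) * S0 ^ (n - k) * expectation (A n k) * D n k)" for n
    by (simp only: atLeast0AtMost mult_ac)
  show ?thesis
  proof (intro conjI allI impI seg EI_pos)
    fix n assume "n \<le> N + 1"
    from AJ_int[OF this] show "integrable M (\<lambda>\<omega>. (P \<omega> - 1) ^ (N + 1 - n) * (I \<omega> - EI) ^ n *
            (LBINT u=0..1. (1 - u) ^ N *
               mixed_partial (N + 1 - n) n (BS_put K r T)
                 ((1 - u) * S0 + u * P \<omega> * S0) ((1 - u) * EI + u * I \<omega>)))"
      unfolding A_def J_def .
  qed (rule price[unfolded swap, unfolded A_def[abs_def] J_def D_def, folded atLeast0AtMost])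
qed

end
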